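(* There is an absolute constant $C>0$ such that for every $n\ge 2$ and every Boolean function $f:\{0,1\}^n\times\{0,1\}^n\to\{0,1\}$, $$Q^{\parallel}(f)\le C\cdot 2^{8\,Q^{pub}(f)}\log n .$$
   Context: All protocols compute $f$ with error probability at most $1/3$ on every input. $Q^{\parallel}(f)$ is the minimal total number of qubits communicated in a quantum simultaneous-message-passing (SMP) protocol for $f$ with no shared randomness and no shared entanglement: Alice (holding $x$) and Bob (holding $y$) each send one quantum message to a referee who holds no input and outputs the answer. $Q^{pub}(f)$ is the minimal number of qubits communicated in a (multi-round, interactive) two-party quantum protocol between Alice and Bob computing $f$, where Alice and Bob share an unlimited amount of public randomness (not counted in the cost) but no prior entanglement. *)

theory Defs
  imports "HOL-Probability.Probability"
begin

text \<open>A d x d complex matrix is a function on indices; only entries with indices below d matter.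
  Vectors are functions nat => complex; only entries below d matter.\<close>

type_synonym cmat = "nat \<Rightarrow> nat \<Rightarrow> complex"
type_synonym cvec = "nat \<Rightarrow> complex"

definition hermitian_m :: "nat \<Rightarrow> cmat \<Rightarrow> bool" where
  "hermitian_m d M \<longleftrightarrow> (\<forall>i<d. \<forall>j<d. M i j = cnj (M j i))"

definition psd_m :: "nat \<Rightarrow> cmat \<Rightarrow> bool" where
  "psd_m d M \<longleftrightarrow> hermitian_m d M \<and>
     (\<forall>v::cvec. 0 \<le> Re (\<Sum>i<d. \<Sum>j<d. cnj (v i) * M i j * v j))"

definition density_m :: "nat \<Rightarrow> cmat \<Rightarrow> bool" where
  "density_m d \<rho> \<longleftrightarrow> psd_m d \<rho> \<and> (\<Sum>i<d. \<rho> i i) = 1"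

definition id_m :: cmat where
  "id_m i j = (if i = j then 1 else 0)"

definition effect_m :: "nat \<Rightarrow> cmat \<Rightarrow> bool" where
  "effect_m d E \<longleftrightarrow> psd_m d E \<and> psd_m d (\<lambda>i j. id_m i j - E i j)"

text \<open>Kronecker product of a 2^a-dim and a 2^b-dim matrix, index i = iA + 2^a * iB.\<close>
definition kron_m :: "nat \<Rightarrow> cmat \<Rightarrow> cmat \<Rightarrow> cmat" where
  "kron_m a \<rho> \<sigma> i j = \<rho> (i mod 2^a) (j mod 2^a) * \<sigma> (i div 2^a) (j div 2^a)"

definition unitary_m :: "nat \<Rightarrow> cmat \<Rightarrow> bool" where
  "unitary_m d U \<longleftrightarrow> (\<forall>i<d. \<forall>k<d. (\<Sum>j<d. cnj (U j i) * U j k) = id_m i k)"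

definition apply_m :: "nat \<Rightarrow> cmat \<Rightarrow> cvec \<Rightarrow> cvec" where
  "apply_m d U v = (\<lambda>j. \<Sum>k<d. U j k * v k)"

text \<open>Alice sends an a-qubit (possibly mixed) state depending on x, Bob a b-qubit state depending
  on y; the referee performs a two-outcome measurement (effect E for output 1) on the joint state.\<close>

definition smp_accept_prob :: "nat \<Rightarrow> nat \<Rightarrow> cmat \<Rightarrow> cmat \<Rightarrow> cmat \<Rightarrow> real" where
  "smp_accept_prob a b E \<rho> \<sigma> =
     Re (\<Sum>i<2^(a+b). \<Sum>j<2^(a+b). E i j * kron_m a \<rho> \<sigma> j i)"

definition smp_protocol :: "nat \<Rightarrow> (bool list \<Rightarrow> bool list \<Rightarrow> bool) \<Rightarrow> nat \<Rightarrow> bool" where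
  "smp_protocol n f c \<longleftrightarrow>
     (\<exists>a b (A :: bool list \<Rightarrow> cmat) (B :: bool list \<Rightarrow> cmat) E.
        a + b \<le> c \<and>
        (\<forall>x. length x = n \<longrightarrow> density_m (2^a) (A x)) \<and>
        (\<forall>y. length y = n \<longrightarrow> density_m (2^b) (B y)) \<and>
        effect_m (2^(a+b)) E \<and>
        (\<forall>x y. length x = n \<longrightarrow> length y = n \<longrightarrow>
           (if f x y then smp_accept_prob a b E (A x) (B y) \<ge> 2/3
            else smp_accept_prob a b E (A x) (B y) \<le> 1/3)))"

definition Q_smp :: "nat \<Rightarrow> (bool list \<Rightarrow> bool list \<Rightarrow> bool) \<Rightarrow> nat" where
  "Q_smp n f = (LEAST c. smp_protocol n f c)"

text \<open>The global system consists of N qubits (basis index j < 2^N, qubit i is bit i of j),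
  initially all |0>; each qubit is owned by Alice (True) or Bob (False). No entanglement
  is shared initially (the initial state is a product basis state). In each round the speaker
  applies a unitary (depending on its input) acting only on the qubits it currently owns,
  and then sends the qubits in the message set M (owned by it) to the other party.
  The cost is the total number of qubits sent.\<close>

definition acts_on :: "nat \<Rightarrow> nat set \<Rightarrow> cmat \<Rightarrow> bool" where
  "acts_on N S U \<longleftrightarrow>
     (\<forall>j<2^N. \<forall>k<2^N. (\<exists>i<N. i \<notin> S \<and> bit j i \<noteq> bit k i) \<longrightarrow> U j k = 0) \<and>
     (\<forall>j<2^N. \<forall>k<2^N. \<forall>j'<2^N. \<forall>k'<2^N.
        (\<forall>i\<in>S. bit j i = bit j' i \<and> bit k i = bit k' i) \<longrightarrow>
        (\<forall>i<N. i \<notin> S \<longrightarrow> bit j i = bit k i) \<longrightarrow>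
        (\<forall>i<N. i \<notin> S \<longrightarrow> bit j' i = bit k' i) \<longrightarrow> U j k = U j' k')"

text \<open>A round: (speaker, input-dependent unitary, set of qubits sent). Speaker True = Alice.\<close>
type_synonym round = "bool \<times> (bool list \<Rightarrow> cmat) \<times> nat set"

fun valid_rounds :: "nat \<Rightarrow> nat \<Rightarrow> (nat \<Rightarrow> bool) \<Rightarrow> round list \<Rightarrow> bool" where
  "valid_rounds n N own [] = True"
| "valid_rounds n N own ((s, U, M) # rs) \<longleftrightarrow>
     (\<forall>z. length z = n \<longrightarrow>
        unitary_m (2^N) (U z) \<and> acts_on N {i. i < N \<and> own i = s} (U z)) \<and>
     M \<subseteq> {i. i < N \<and> own i = s} \<and>
     valid_rounds n N (\<lambda>i. if i \<in> M then \<not> s else own i) rs"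

fun comm_cost :: "round list \<Rightarrow> nat" where
  "comm_cost [] = 0"
| "comm_cost ((s, U, M) # rs) = card M + comm_cost rs"

fun run_rounds :: "nat \<Rightarrow> bool list \<Rightarrow> bool list \<Rightarrow> round list \<Rightarrow> cvec \<Rightarrow> cvec" where
  "run_rounds N x y [] v = v"
| "run_rounds N x y ((s, U, M) # rs) v =
     run_rounds N x y rs (apply_m (2^N) (U (if s then x else y)) v)"

text \<open>A deterministic protocol: (N, initial ownership, rounds, output qubit).
  The output is the result of measuring the output qubit in the computational basis.\<close>
type_synonym qprotocol = "nat \<times> (nat \<Rightarrow> bool) \<times> round list \<times> nat"

definition valid_qprotocol :: "nat \<Rightarrow> qprotocol \<Rightarrow> bool" where
  "valid_qprotocol n p = (case p of (N, own, rs, out) \<Rightarrow> out < N \<and> valid_rounds n N own rs)"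

definition qprotocol_cost :: "qprotocol \<Rightarrow> nat" where
  "qprotocol_cost p = (case p of (N, own, rs, out) \<Rightarrow> comm_cost rs)"

definition init_state :: cvec where
  "init_state j = (if j = 0 then 1 else 0)"

definition prob_output_one :: "qprotocol \<Rightarrow> bool list \<Rightarrow> bool list \<Rightarrow> real" where
  "prob_output_one p x y = (case p of (N, own, rs, out) \<Rightarrow>
     (\<Sum>j<2^N. if bit j out then (cmod (run_rounds N x y rs init_state j))^2 else 0))"

text \<open>A public-coin protocol is a probability distribution over deterministic protocols
  (the public random string selects the protocol).\<close>
definition pub_protocol :: "nat \<Rightarrow> (bool list \<Rightarrow> bool list \<Rightarrow> bool) \<Rightarrow> nat \<Rightarrow> qprotocol pmf \<Rightarrow> bool" where
  "pub_protocol n f c P \<longleftrightarrow>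
     (\<forall>p\<in>set_pmf P. valid_qprotocol n p \<and> qprotocol_cost p \<le> c) \<and>
     (\<forall>x y. length x = n \<longrightarrow> length y = n \<longrightarrow>
        measure_pmf.expectation P (\<lambda>p. if f x y then prob_output_one p x y
                                      else 1 - prob_output_one p x y) \<ge> 2/3)"

definition Q_pub :: "nat \<Rightarrow> (bool list \<Rightarrow> bool list \<Rightarrow> bool) \<Rightarrow> nat" where
  "Q_pub n f = (LEAST c. \<exists>P. pub_protocol n f c P)"

end

theory Submission
  imports Defs "HOL-Library.Nat_Bijection"
begin

text \<open>By Yao's decomposition, the acceptance probability of a q-qubit protocol is an inner product of
  a vector depending on x and a vector depending on y, in dimension \<open>4^q\<close> and of squared norm at most
  \<open>4^q\<close>. After Newman's reduction to O(n) public seeds, the superpositions over the seeds of these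
  vectors, padded to unit length, live on O(q + log n) qubits, and their inner product is the
  acceptance probability divided by \<open>4^q\<close>. The referee tells the two cases apart with \<open>O(2^(8q))\<close>
  swap tests. If \<open>2^(8q) \<ge> 2n\<close>, sending the inputs is cheap enough; otherwise q = O(log n).\<close>

section \<open>Effects and swap tests\<close>

text \<open>A swap test sees only the squared modulus of an inner product. It can still compare
  probabilities, because the inner products here are nonnegative reals, where squaring keeps the
  order. The exponent 8 comes from three losses. An amplitude has one term per transcript, so the
  acceptance probability, quadratic in the amplitudes, is a sum over pairs of transcripts, and
  normalizing costs a factor \<open>4^q\<close>. Squaring turns a constant gap into one of order
  \<open>1/L\<close> with \<open>L = 2^(4*q)\<close>. Sampling noise falls below such a gap only
  after order \<open>L^2\<close> repetitions. The seeds enter as coordinates of a superposition, so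
  their number costs only its logarithm. The obstacle in the formalization is the referee's
  measurement, one effect on all registers at once. Reading indices in base \<open>D\<close> lets
  the test, the messages and the acceptance probability follow a single recursion on the number of
  swap tests.\<close>

definition quad :: "'k set \<Rightarrow> ('k \<Rightarrow> 'k \<Rightarrow> complex) \<Rightarrow> ('k \<Rightarrow> complex) \<Rightarrow> complex" where
  "quad S F v = (\<Sum>s\<in>S. \<Sum>t\<in>S. cnj (v s) * F s t * v t)"

definition psd_on :: "'k set \<Rightarrow> ('k \<Rightarrow> 'k \<Rightarrow> complex) \<Rightarrow> bool" where
  "psd_on S F \<longleftrightarrow> (\<forall>s\<in>S. \<forall>t\<in>S. F s t = cnj (F t s)) \<and> (\<forall>v. 0 \<le> Re (quad S F v))"

definition id_on :: "'k \<Rightarrow> 'k \<Rightarrow> complex" where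
  "id_on s t = (if s = t then 1 else 0)"

definition effect_on :: "'k set \<Rightarrow> ('k \<Rightarrow> 'k \<Rightarrow> complex) \<Rightarrow> bool" where
  "effect_on S E \<longleftrightarrow> psd_on S E \<and> psd_on S (\<lambda>s t. id_on s t - E s t)"

section \<open>Quadratic forms, positivity and effects over arbitrary index sets\<close>

lemma psd_m_iff: "psd_m d M \<longleftrightarrow> psd_on {..<d} M"
  by (auto simp: psd_m_def psd_on_def hermitian_m_def quad_def)

lemma effect_m_iff: "effect_m d E \<longleftrightarrow> effect_on {..<d} E"
  by (simp add: effect_m_def effect_on_def psd_m_iff id_m_def id_on_def)

lemma quad_add: "quad S (\<lambda>s t. F s t + G s t) v = quad S F v + quad S G v"
  by (simp add: quad_def ring_distribs sum.distrib)

lemma quad_id: "finite S \<Longrightarrow> quad S id_on v = of_real (\<Sum>s\<in>S. (cmod (v s))\<^sup>2)"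
  by (simp add: quad_def id_on_def if_distrib[of "\<lambda>z. _ * z"] if_distrib[of "\<lambda>z. z * _"]
      sum.delta cong: if_cong)
    (simp add: complex_norm_square[symmetric] mult.commute[of "cnj _"])

lemma psd_on_add: "psd_on S F \<Longrightarrow> psd_on S G \<Longrightarrow> psd_on S (\<lambda>s t. F s t + G s t)"
  unfolding psd_on_def quad_add by (metis add_nonneg_nonneg complex_cnj_add plus_complex.sel(1))

lemma psd_on_id: "finite S \<Longrightarrow> psd_on S id_on"
  by (auto simp: psd_on_def quad_id id_on_def sum_nonneg)

lemma psd_on_zero: "psd_on S (\<lambda>s t. 0)"
  by (simp add: psd_on_def quad_def)

lemma psd_on_cong:
  "(\<And>s t. s \<in> S \<Longrightarrow> t \<in> S \<Longrightarrow> F s t = G s t) \<Longrightarrow> psd_on S F = psd_on S G"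
  by (simp add: psd_on_def quad_def)

lemma quad_reindex:
  assumes "bij_betw h S' S"
  shows "quad S' (\<lambda>s t. F (h s) (h t)) (\<lambda>s. v (h s)) = quad S F v"
  unfolding quad_def
  by (simp add: sum.reindex_bij_betw[OF assms, where g = "\<lambda>t. cnj (v _) * F _ t * v t"]
      sum.reindex_bij_betw[OF assms, where g = "\<lambda>s. \<Sum>t\<in>S. cnj (v s) * F s t * v t"])

lemma psd_on_reindex:
  assumes h: "bij_betw h S' S" and F: "psd_on S F"
  shows "psd_on S' (\<lambda>s t. F (h s) (h t))"
  unfolding psd_on_def
proof (intro conjI ballI allI)
  fix s t assume "s \<in> S'" "t \<in> S'"
  then show "F (h s) (h t) = cnj (F (h t) (h s))"
    using F bij_betwE[OF h] unfolding psd_on_def by blast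
next
  fix v
  \<comment> \<open>On \<open>S'\<close> every vector is the pullback along \<open>h\<close> of a
    vector on \<open>S\<close>, so positivity on \<open>S\<close> applies to it.\<close>
  have "quad S' (\<lambda>s t. F (h s) (h t)) v =
        quad S' (\<lambda>s t. F (h s) (h t)) (\<lambda>s. v (inv_into S' h (h s)))"
    using h by (simp add: quad_def bij_betw_def)
  also have "\<dots> = quad S F (\<lambda>s. v (inv_into S' h s))"
    using quad_reindex[OF h, of F "\<lambda>s. v (inv_into S' h s)"] by simp
  finally show "0 \<le> Re (quad S' (\<lambda>s t. F (h s) (h t)) v)"
    using F by (simp add: psd_on_def)
qed

text \<open>The referee's effect is built on pairs of registers, split further into digits; this
  carries it along each change of indexing, up to the numeric indices of
  \<open>effect_m\<close>.\<close>

lemma effect_on_reindex: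
  assumes h: "bij_betw h S' S" and F: "effect_on S F"
  shows "effect_on S' (\<lambda>s t. F (h s) (h t))"
proof -
  have "id_on (h s) (h t) = id_on s t" if "s \<in> S'" "t \<in> S'" for s t
    using h that by (auto simp: id_on_def bij_betw_def inj_on_def)
  then show ?thesis
    using F psd_on_reindex[OF h, of F] psd_on_reindex[OF h, of "\<lambda>s t. id_on s t - F s t"]
    unfolding effect_on_def by (auto cong: psd_on_cong)
qed

lemma quad_tensor:
  "quad (S \<times> S') (\<lambda>p q. F (fst p) (fst q) * G (snd p) (snd q)) (\<lambda>p. v (fst p) * w (snd p))
   = quad S F v * quad S' G w"
proof -
  have "quad (S \<times> S') (\<lambda>p q. F (fst p) (fst q) * G (snd p) (snd q)) (\<lambda>p. v (fst p) * w (snd p))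
    = (\<Sum>s\<in>S. \<Sum>s'\<in>S'. \<Sum>t\<in>S. \<Sum>t'\<in>S'.
        (cnj (v s) * F s t * v t) * (cnj (w s') * G s' t' * w t'))"
    unfolding quad_def sum.cartesian_product' by (intro sum.cong refl) (simp add: mult_ac)
  also have "\<dots> = quad S F v * quad S' G w"
    by (simp only: quad_def sum_product)
  finally show ?thesis .
qed

text \<open>Writing \<open>G\<close> as a Gram matrix of \<open>H\<close> turns the form at
  \<open>v\<close> into a sum over \<open>k\<close> of the form of \<open>F\<close> at
  \<open>v\<close> contracted with row \<open>k\<close> of \<open>H\<close>. For swap tests
  \<open>H\<close> is the projector itself.\<close>

lemma psd_on_tensor:
  assumes F: "psd_on S F"
    and G: "\<And>s t. s \<in> S' \<Longrightarrow> t \<in> S' \<Longrightarrow> G s t = (\<Sum>k\<in>S'. cnj (H k s) * H k t)"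
  shows "psd_on (S \<times> S') (\<lambda>p q. F (fst p) (fst q) * G (snd p) (snd q))"
  unfolding psd_on_def
proof (intro conjI ballI allI)
  fix p q assume "p \<in> S \<times> S'" "q \<in> S \<times> S'"
  moreover have "G s t = cnj (G t s)" if "s \<in> S'" "t \<in> S'" for s t
    by (simp add: G[OF that] G[OF that(2,1)] mult.commute)
  moreover have "F s t = cnj (F t s)" if "s \<in> S" "t \<in> S" for s t
    using that F unfolding psd_on_def by blast
  ultimately show "F (fst p) (fst q) * G (snd p) (snd q) = cnj (F (fst q) (fst p) * G (snd q) (snd p))"
    by (metis complex_cnj_mult mem_Times_iff)
next
  fix v :: "'a \<times> 'b \<Rightarrow> complex"
  have "quad (S \<times> S') (\<lambda>p q. F (fst p) (fst q) * G (snd p) (snd q)) v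
      = (\<Sum>s\<in>S. \<Sum>s'\<in>S'. \<Sum>t\<in>S. \<Sum>t'\<in>S'. cnj (v (s, s')) * (F s t * G s' t') * v (t, t'))"
    by (simp add: quad_def sum.cartesian_product')
  also have "\<dots> = (\<Sum>s\<in>S. \<Sum>s'\<in>S'. \<Sum>t\<in>S. \<Sum>t'\<in>S'. \<Sum>k\<in>S'.
      cnj (H k s' * v (s, s')) * F s t * (H k t' * v (t, t')))"
    by (intro sum.cong refl) (simp add: G sum_distrib_left sum_distrib_right mult_ac)
  \<comment> \<open>The exchanges up to the last form bring \<open>k\<close> outermost and
    \<open>s'\<close> inside \<open>t\<close>, so that the two inner sums become the contracted
    vector and its conjugate.\<close>
  also have "\<dots> = (\<Sum>s\<in>S. \<Sum>s'\<in>S'. \<Sum>t\<in>S. \<Sum>k\<in>S'. \<Sum>t'\<in>S'.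
      cnj (H k s' * v (s, s')) * F s t * (H k t' * v (t, t')))"
    by (rule sum.cong[OF refl], rule sum.cong[OF refl], rule sum.cong[OF refl], rule sum.swap)
  also have "\<dots> = (\<Sum>s\<in>S. \<Sum>s'\<in>S'. \<Sum>k\<in>S'. \<Sum>t\<in>S. \<Sum>t'\<in>S'.
      cnj (H k s' * v (s, s')) * F s t * (H k t' * v (t, t')))"
    by (rule sum.cong[OF refl], rule sum.cong[OF refl], rule sum.swap)
  also have "\<dots> = (\<Sum>s\<in>S. \<Sum>k\<in>S'. \<Sum>s'\<in>S'. \<Sum>t\<in>S. \<Sum>t'\<in>S'.
      cnj (H k s' * v (s, s')) * F s t * (H k t' * v (t, t')))"
    by (rule sum.cong[OF refl], rule sum.swap)
  also have "\<dots> = (\<Sum>k\<in>S'. \<Sum>s\<in>S. \<Sum>s'\<in>S'. \<Sum>t\<in>S. \<Sum>t'\<in>S'.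
      cnj (H k s' * v (s, s')) * F s t * (H k t' * v (t, t')))"
    by (rule sum.swap)
  also have "\<dots> = (\<Sum>k\<in>S'. \<Sum>s\<in>S. \<Sum>t\<in>S. \<Sum>s'\<in>S'. \<Sum>t'\<in>S'.
      cnj (H k s' * v (s, s')) * F s t * (H k t' * v (t, t')))"
    by (rule sum.cong[OF refl], rule sum.cong[OF refl], rule sum.swap)
  also have "\<dots> = (\<Sum>k\<in>S'. quad S F (\<lambda>s. \<Sum>s'\<in>S'. H k s' * v (s, s')))"
    by (simp only: quad_def cnj_sum sum_distrib_right) (simp only: sum_distrib_left)
  finally show "0 \<le> Re (quad (S \<times> S') (\<lambda>p q. F (fst p) (fst q) * G (snd p) (snd q)) v)"
    using F by (simp add: psd_on_def sum_nonneg)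
qed

section \<open>The swap test: the projectors (I + SWAP)/2 and (I - SWAP)/2 onto the symmetric and
  antisymmetric subspaces\<close>

definition swap_test :: "bool \<Rightarrow> nat \<times> nat \<Rightarrow> nat \<times> nat \<Rightarrow> complex" where
  "swap_test c s t = (id_on s t + (if c then 1 else -1) * id_on s (prod.swap t)) / 2"

text \<open>SWAP is a self-adjoint involution. Expanding the product gives four delta sums, which
  equal I and SWAP twice each. The Gram form is what \<open>psd_on_tensor\<close> asks for.\<close>

lemma swap_test_projector:
  assumes "s \<in> {..<D} \<times> {..<D}" "t \<in> {..<D} \<times> {..<D}"
  shows "swap_test c s t =
    (\<Sum>k\<in>{..<D} \<times> {..<D}. cnj (swap_test c k s) * swap_test c k t)"
proof -
  have delta: "(\<Sum>k\<in>{..<D} \<times> {..<D}. id_on k p * id_on k r) = id_on p r"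
    if "p \<in> {..<D} \<times> {..<D}" for p r :: "nat \<times> nat"
    using that by (simp add: id_on_def if_distrib[of "\<lambda>z. z * _"] sum.delta cong: if_cong)
  have c: "cnj (id_on p r) = id_on p r" for p r :: "nat \<times> nat" by (simp add: id_on_def)
  define e :: complex where "e = (if c then 1 else -1)"
  have e: "e * e = 1" "cnj e = e" by (auto simp: e_def)
  have m: "prod.swap s \<in> {..<D} \<times> {..<D}" using assms by auto
  have "(\<Sum>k\<in>{..<D} \<times> {..<D}. cnj (swap_test c k s) * swap_test c k t)
    = (\<Sum>k\<in>{..<D} \<times> {..<D}. (id_on k s * id_on k t + e * (id_on k s * id_on k (prod.swap t))
        + e * (id_on k (prod.swap s) * id_on k t)
        + (e * e) * (id_on k (prod.swap s) * id_on k (prod.swap t))) / 4)"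
    by (intro sum.cong refl) (simp add: swap_test_def c e e_def[symmetric] field_simps)
  also have "\<dots> = (id_on s t + e * id_on s (prod.swap t) + e * id_on (prod.swap s) t
        + id_on (prod.swap s) (prod.swap t)) / 4"
    by (simp only: sum_divide_distrib[symmetric] sum.distrib sum_distrib_left[symmetric]
        delta[OF assms(1)] delta[OF m] e mult_1_left)
  also have "\<dots> = swap_test c s t"
  proof -
    have "id_on (prod.swap s) t = id_on s (prod.swap t)" "id_on (prod.swap s) (prod.swap t) = id_on s t"
      by (cases s; cases t; auto simp: id_on_def)+
    then show ?thesis by (simp add: swap_test_def e_def field_simps)
  qed
  finally show ?thesis by simp
qed

lemma swap_test_sum: "swap_test True s t + swap_test False s t = id_on s t"
  by (simp add: swap_test_def field_simps)

text \<open>On a product vector the expectation of SWAP factors into the inner product of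
  \<open>a\<close> and \<open>b\<close> and its conjugate.\<close>

lemma quad_swap_test:
  assumes "(\<Sum>k<D. (cmod (a k))\<^sup>2) = 1" "(\<Sum>k<D. (cmod (b k))\<^sup>2) = 1"
  shows "quad ({..<D} \<times> {..<D}) (swap_test c) (\<lambda>p. a (fst p) * b (snd p)) =
    of_real ((1 + (if c then 1 else -1) * (cmod (\<Sum>k<D. cnj (a k) * b k))\<^sup>2) / 2)"
proof -
  let ?S = "{..<D} \<times> {..<D}"
  let ?v = "\<lambda>p::nat\<times>nat. a (fst p) * b (snd p)"
  define e :: real where "e = (if c then 1 else -1)"
  have 1: "quad ?S id_on ?v = 1"
  proof -
    have "(\<Sum>s\<in>?S. (cmod (?v s))\<^sup>2) = (\<Sum>k<D. (cmod (a k))\<^sup>2) * (\<Sum>k<D. (cmod (b k))\<^sup>2)"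
      by (simp add: sum_product sum.cartesian_product norm_mult power_mult_distrib case_prod_beta)
    then show ?thesis using assms by (simp add: quad_id)
  qed
  have "quad ?S (\<lambda>s t. id_on s (prod.swap t)) ?v = (\<Sum>s\<in>?S. cnj (?v s) * ?v (prod.swap s))"
    unfolding quad_def
  proof (intro sum.cong refl)
    fix s assume s: "s \<in> ?S"
    have "(\<Sum>t\<in>?S. cnj (?v s) * id_on s (prod.swap t) * ?v t)
      = (\<Sum>t\<in>?S. if t = prod.swap s then cnj (?v s) * ?v t else 0)"
      by (intro sum.cong refl) (auto simp: id_on_def)
    also have "\<dots> = cnj (?v s) * ?v (prod.swap s)"
      using s by (subst sum.delta) auto
    finally show "(\<Sum>t\<in>?S. cnj (?v s) * id_on s (prod.swap t) * ?v t) = cnj (?v s) * ?v (prod.swap s)" .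
  qed
  also have "\<dots> = (\<Sum>i<D. \<Sum>j<D. (cnj (a i) * b i) * (a j * cnj (b j)))"
    by (simp add: sum.cartesian_product case_prod_beta mult_ac)
  also have "\<dots> = (\<Sum>k<D. cnj (a k) * b k) * cnj (\<Sum>k<D. cnj (a k) * b k)"
    by (simp add: sum_product)
  also have "\<dots> = of_real ((cmod (\<Sum>k<D. cnj (a k) * b k))\<^sup>2)"
    by (simp only: complex_norm_square)
  finally have 2: "quad ?S (\<lambda>s t. id_on s (prod.swap t)) ?v =
    of_real ((cmod (\<Sum>k<D. cnj (a k) * b k))\<^sup>2)" .
  have "quad ?S (swap_test c) ?v =
      (quad ?S id_on ?v + of_real e * quad ?S (\<lambda>s t. id_on s (prod.swap t)) ?v) / 2"
    by (cases c) (simp_all add: quad_def swap_test_def e_def sum_divide_distrib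
        sum.distrib[symmetric] sum_subtractf[symmetric] ring_distribs diff_divide_distrib add_divide_distrib)
  then show ?thesis unfolding 1 2 e_def by simp
qed

section \<open>Digit expansions of indices, tensor powers and the threshold test\<close>

lemma bij_betw_mod_div:
  assumes "0 < (A::nat)"
  shows "bij_betw (\<lambda>i. (i mod A, i div A)) {..<A * B} ({..<A} \<times> {..<B})"
  unfolding bij_betw_def
proof
  show "inj_on (\<lambda>i. (i mod A, i div A)) {..<A * B}"
    by (auto simp: inj_on_def) (metis mult_div_mod_eq)
  have "(i, j) \<in> (\<lambda>i. (i mod A, i div A)) ` {..<A * B}" if "i < A" "j < B" for i j
  proof
    show "(i, j) = ((i + A * j) mod A, (i + A * j) div A)" using that by simp
    have "i + A * j < A * Suc j" using that by simp
    also have "\<dots> \<le> A * B" using that by (intro mult_le_mono2) simp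
    finally show "i + A * j \<in> {..<A * B}" by simp
  qed
  then show "(\<lambda>i. (i mod A, i div A)) ` {..<A * B} = {..<A} \<times> {..<B}"
    using assms by (auto simp: less_mult_imp_div_less mult.commute)
qed

lemma sum_mod_div:
  fixes g :: "nat \<Rightarrow> nat \<Rightarrow> 'a :: comm_monoid_add"
  assumes "0 < A"
  shows "(\<Sum>i<A * B. g (i mod A) (i div A)) = (\<Sum>i<A. \<Sum>j<B. g i j)"
  using sum.reindex_bij_betw[OF bij_betw_mod_div[OF assms], of "\<lambda>p. g (fst p) (snd p)" B]
  by (simp add: sum.cartesian_product case_prod_beta)

definition high_digits :: "nat \<Rightarrow> nat \<times> nat \<Rightarrow> nat \<times> nat" where
  "high_digits D s = (fst s div D, snd s div D)"

definition last_digits :: "nat \<Rightarrow> nat \<times> nat \<Rightarrow> nat \<times> nat" where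
  "last_digits D s = (fst s mod D, snd s mod D)"

lemma bij_betw_digits:
  assumes "0 < D"
  shows "bij_betw (\<lambda>s. (high_digits D s, last_digits D s)) ({..<D * B} \<times> {..<D * B})
    (({..<B} \<times> {..<B}) \<times> ({..<D} \<times> {..<D}))"
proof -
  have m: "i + D * j < D * B" if "i < D" "j < B" for i j
  proof -
    have "i + D * j < D * Suc j" using that by simp
    also have "\<dots> \<le> D * B" using that by (intro mult_le_mono2) simp
    finally show ?thesis .
  qed
  show ?thesis
    by (rule bij_betw_byWitness[where
          f' = "\<lambda>(s, t). (fst t + D * fst s, snd t + D * snd s)"])
      (use assms m in \<open>auto simp: high_digits_def last_digits_def less_mult_imp_div_less mult.commute\<close>)
qed

text \<open>The referee performs T swap tests on disjoint pairs of registers, where a register of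
  dimension D is one base-D digit, and accepts iff at least h of the tests pass.\<close>

fun threshold_test :: "nat \<Rightarrow> nat \<Rightarrow> nat \<Rightarrow> nat \<times> nat \<Rightarrow> nat \<times> nat \<Rightarrow> complex" where
  "threshold_test D T 0 = id_on"
| "threshold_test D 0 (Suc h) = (\<lambda>s t. 0)"
| "threshold_test D (Suc T) (Suc h) = (\<lambda>s t.
     threshold_test D T h (high_digits D s) (high_digits D t)
       * swap_test True (last_digits D s) (last_digits D t)
   + threshold_test D T (Suc h) (high_digits D s) (high_digits D t)
       * swap_test False (last_digits D s) (last_digits D t))"

text \<open>The \<open>T\<close>-fold tensor power of \<open>a\<close>, with one
  base-\<open>D\<close> digit per factor, peeled off in the same order as in
  \<open>threshold_test\<close>.\<close>

fun copies :: "nat \<Rightarrow> nat \<Rightarrow> (nat \<Rightarrow> complex) \<Rightarrow> nat \<Rightarrow> complex" where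
  "copies D 0 a i = 1"
| "copies D (Suc T) a i = copies D T a (i div D) * a (i mod D)"

text \<open>The probability of at least \<open>h\<close> successes in \<open>T\<close> independent
  trials, by conditioning on one trial. This is the recursion of \<open>threshold_test\<close>, so
  no binomial coefficients enter.\<close>

fun binomial_tail :: "nat \<Rightarrow> nat \<Rightarrow> real \<Rightarrow> real" where
  "binomial_tail T 0 p = 1"
| "binomial_tail 0 (Suc h) p = 0"
| "binomial_tail (Suc T) (Suc h) p = p * binomial_tail T h p + (1 - p) * binomial_tail T (Suc h) p"

lemma sum_norm_copies:
  assumes "0 < D" "(\<Sum>k<D. (cmod (a k))\<^sup>2) = 1"
  shows "(\<Sum>i<D^T. (cmod (copies D T a i))\<^sup>2) = 1"
proof (induction T)
  case 0
  then show ?case by simp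
next
  case (Suc T)
  have "(\<Sum>i<D^Suc T. (cmod (copies D (Suc T) a i))\<^sup>2)
     = (\<Sum>i<D. \<Sum>j<D^T. (cmod (copies D T a j))\<^sup>2 * (cmod (a i))\<^sup>2)"
    using sum_mod_div[OF assms(1), of "\<lambda>i j. (cmod (copies D T a j))\<^sup>2 * (cmod (a i))\<^sup>2" "D^T"]
    by (simp add: norm_mult power_mult_distrib)
  also have "\<dots> = 1"
    by (simp add: sum_distrib_right[symmetric] Suc assms)
  finally show ?case .
qed

text \<open>The state is a product over digit positions, so peeling off the last digit of both
  registers multiplies forms: the swap tests behave like independent coins.\<close>

lemma quad_threshold_test:
  assumes D: "0 < D" and a: "(\<Sum>k<D. (cmod (a k))\<^sup>2) = 1" and b: "(\<Sum>k<D. (cmod (b k))\<^sup>2) = 1"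
  shows "quad ({..<D^T} \<times> {..<D^T}) (threshold_test D T h) (\<lambda>p. copies D T a (fst p) * copies D T b (snd p))
    = of_real (binomial_tail T h ((1 + (cmod (\<Sum>k<D. cnj (a k) * b k))\<^sup>2) / 2))"
proof (induction T arbitrary: h)
  case 0
  have "{..<D^0} \<times> {..<D^0} = {(0::nat, 0::nat)}" by auto
  then show ?case by (cases h) (simp_all add: quad_def id_on_def)
next
  case (Suc T)
  show ?case
  proof (cases h)
    case 0
    have "(\<Sum>s\<in>{..<D^Suc T} \<times> {..<D^Suc T}. (cmod (copies D (Suc T) a (fst s) * copies D (Suc T) b (snd s)))\<^sup>2)
      = (\<Sum>i<D^Suc T. (cmod (copies D (Suc T) a i))\<^sup>2) * (\<Sum>i<D^Suc T. (cmod (copies D (Suc T) b i))\<^sup>2)"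
      by (simp add: sum_product sum.cartesian_product norm_mult power_mult_distrib case_prod_beta
          del: copies.simps power_Suc)
    then show ?thesis
      using sum_norm_copies[OF D a, of "Suc T"] sum_norm_copies[OF D b, of "Suc T"] 0
      by (simp add: quad_id del: copies.simps power_Suc)
  next
    case (Suc h')
    let ?S = "{..<D^T} \<times> {..<D^T}" and ?P = "{..<D} \<times> {..<D}"
    let ?v = "\<lambda>p. copies D T a (fst p) * copies D T b (snd p)"
    let ?w = "\<lambda>p. a (fst p) * b (snd p)"
    let ?F = "\<lambda>p q. threshold_test D T h' (fst p) (fst q) * swap_test True (snd p) (snd q)
        + threshold_test D T (Suc h') (fst p) (fst q) * swap_test False (snd p) (snd q)"
    define p where "p = (1 + (cmod (\<Sum>k<D. cnj (a k) * b k))\<^sup>2) / 2"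
    have p': "1 - p = (1 - (cmod (\<Sum>k<D. cnj (a k) * b k))\<^sup>2) / 2"
      by (simp add: p_def field_simps)
    have "quad ({..<D^Suc T} \<times> {..<D^Suc T}) (threshold_test D (Suc T) h)
        (\<lambda>p. copies D (Suc T) a (fst p) * copies D (Suc T) b (snd p))
      = quad (?S \<times> ?P) ?F (\<lambda>p. ?v (fst p) * ?w (snd p))"
      by (subst quad_reindex[OF bij_betw_digits[OF D], symmetric])
        (simp add: Suc high_digits_def last_digits_def mult_ac)
    also have "\<dots> = quad ?S (threshold_test D T h') ?v * quad ?P (swap_test True) ?w
        + quad ?S (threshold_test D T (Suc h')) ?v * quad ?P (swap_test False) ?w"
      by (simp only: quad_add quad_tensor[where v = ?v and w = ?w])
    also have "\<dots> = of_real (binomial_tail T h' p * p + binomial_tail T (Suc h') p * (1 - p))"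
      unfolding Suc.IH quad_swap_test[OF a b] p' by (simp add: p_def)
    also have "\<dots> = of_real (binomial_tail (Suc T) h p)"
      by (simp add: Suc mult.commute)
    finally show ?thesis unfolding p_def .
  qed
qed

text \<open>The two swap-test projectors add up to the identity, so the complement of the mixture is
  the same mixture of the complements of \<open>F\<close> and \<open>G\<close>. One positivity
  argument then settles both halves of being an effect.\<close>

lemma effect_on_swap_mixture:
  assumes F: "effect_on S F" and G: "effect_on S G"
  shows "effect_on (S \<times> ({..<D} \<times> {..<D}))
    (\<lambda>p q. F (fst p) (fst q) * swap_test True (snd p) (snd q)
         + G (fst p) (fst q) * swap_test False (snd p) (snd q))"
proof -
  have 1: "psd_on (S \<times> ({..<D} \<times> {..<D}))
    (\<lambda>p q. F (fst p) (fst q) * swap_test True (snd p) (snd q)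
         + G (fst p) (fst q) * swap_test False (snd p) (snd q))"
    if "psd_on S F" "psd_on S G" for F G
    by (intro psd_on_add psd_on_tensor[where H = "swap_test True"]
        psd_on_tensor[where H = "swap_test False"] that swap_test_projector)
  have 2: "id_on p q - (F (fst p) (fst q) * swap_test True (snd p) (snd q)
         + G (fst p) (fst q) * swap_test False (snd p) (snd q))
     = (id_on (fst p) (fst q) - F (fst p) (fst q)) * swap_test True (snd p) (snd q)
         + (id_on (fst p) (fst q) - G (fst p) (fst q)) * swap_test False (snd p) (snd q)" for p q
  proof -
    have "id_on p q = id_on (fst p) (fst q) * (swap_test True (snd p) (snd q) + swap_test False (snd p) (snd q))"
      unfolding swap_test_sum by (simp add: id_on_def prod_eq_iff)
    then show ?thesis by (simp add: algebra_simps)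
  qed
  show ?thesis
    using 1[of F G] 1[of "\<lambda>s t. id_on s t - F s t" "\<lambda>s t. id_on s t - G s t"] F G
    unfolding effect_on_def 2 by blast
qed

lemma effect_threshold_test:
  assumes D: "0 < D"
  shows "effect_on ({..<D^T} \<times> {..<D^T}) (threshold_test D T h)"
proof (induction T arbitrary: h)
  case 0
  show ?case
    by (cases h) (simp_all add: effect_on_def psd_on_id psd_on_zero)
next
  case (Suc T)
  show ?case
  proof (cases h)
    case 0
    then show ?thesis by (simp add: effect_on_def psd_on_id psd_on_zero)
  next
    case (Suc h')
    have "effect_on ({..<D * D^T} \<times> {..<D * D^T}) (threshold_test D (Suc T) (Suc h'))"
      using effect_on_reindex[OF bij_betw_digits[OF D]
          effect_on_swap_mixture[OF Suc.IH[of h'] Suc.IH[of "Suc h'"]]] by simp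
    then show ?thesis using Suc by simp
  qed
qed

section \<open>Tail bounds for the binomial distribution\<close>

lemma binomial_tail_bounds:
  assumes "0 \<le> p" "p \<le> 1"
  shows "0 \<le> binomial_tail T h p \<and> binomial_tail T h p \<le> 1"
  using assms
proof (induction T h p rule: binomial_tail.induct)
  case (3 T h p)
  then show ?case
    using convex_bound_le[of "binomial_tail T h p" 1 "binomial_tail T (Suc h) p" p "1 - p"] by simp
qed simp_all

text \<open>Chebyshev's inequality, proved for a free centre c because the induction shifts it.\<close>

lemma binomial_tail_upper:
  assumes "0 \<le> p" "p \<le> 1" "c \<le> real h"
  shows "binomial_tail T h p * (real h - c)\<^sup>2 \<le> T * p * (1 - p) + (T * p - c)\<^sup>2"
  using assms
proof (induction T h p arbitrary: c rule: binomial_tail.induct)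
  case (1 T p)
  have "(- c)\<^sup>2 \<le> (T * p - c)\<^sup>2"
    using 1 by (intro power_mono) auto
  moreover have "0 \<le> T * p * (1 - p)" using 1 by simp
  ultimately show ?case by simp
next
  case (2 h p)
  then show ?case by simp
next
  case (3 T h p)
  \<comment> \<open>A success lowers the threshold by one; lowering the centre along with it keeps
    their distance.\<close>
  have "binomial_tail T h p * (real h - (c - 1))\<^sup>2 \<le> T * p * (1 - p) + (T * p - (c - 1))\<^sup>2"
    using 3 by (intro 3) auto
  then have A: "p * (binomial_tail T h p * (real (Suc h) - c)\<^sup>2) \<le> p * (T * p * (1 - p) + (T * p - (c - 1))\<^sup>2)"
    using 3 by (intro mult_left_mono) (simp_all add: algebra_simps)
  have B: "(1 - p) * (binomial_tail T (Suc h) p * (real (Suc h) - c)\<^sup>2) \<le> (1 - p) * (T * p * (1 - p) + (T * p - c)\<^sup>2)"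
    using 3 by (intro mult_left_mono 3) auto
  have "binomial_tail (Suc T) (Suc h) p * (real (Suc h) - c)\<^sup>2
    \<le> p * (T * p * (1 - p) + (T * p - (c - 1))\<^sup>2) + (1 - p) * (T * p * (1 - p) + (T * p - c)\<^sup>2)"
    using add_mono[OF A B] by (simp add: ring_distribs mult.assoc)
  \<comment> \<open>The right-hand side is the second moment of the binomial variable about
    \<open>c\<close>; one more trial shifts the mean by \<open>p\<close> and adds
    \<open>p * (1 - p)\<close> to the variance.\<close>
  also have "\<dots> = Suc T * p * (1 - p) + (Suc T * p - c)\<^sup>2"
    by (simp add: algebra_simps power2_eq_square)
  finally show ?case .
qed

text \<open>Chebyshev on the other side, for a centre above the threshold. At
  \<open>c = T * p\<close> it bounds the chance of missing the threshold by the variance.\<close>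

lemma binomial_tail_lower:
  assumes "0 \<le> p" "p \<le> 1" "real h \<le> c"
  shows "(1 - binomial_tail T h p) * (c - real h)\<^sup>2 \<le> T * p * (1 - p) + (T * p - c)\<^sup>2"
  using assms
proof (induction T h p arbitrary: c rule: binomial_tail.induct)
  case (1 T p)
  then show ?case by simp
next
  case (2 h p)
  then have "(c - real (Suc h))\<^sup>2 \<le> c\<^sup>2" by (intro power_mono) auto
  then show ?case by simp
next
  case (3 T h p)
  have "(1 - binomial_tail T h p) * ((c - 1) - real h)\<^sup>2 \<le> T * p * (1 - p) + (T * p - (c - 1))\<^sup>2"
    using 3 by (intro 3) auto
  then have A: "p * ((1 - binomial_tail T h p) * (c - real (Suc h))\<^sup>2) \<le> p * (T * p * (1 - p) + (T * p - (c - 1))\<^sup>2)"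
    using 3 by (intro mult_left_mono) (simp_all add: algebra_simps)
  have B: "(1 - p) * ((1 - binomial_tail T (Suc h) p) * (c - real (Suc h))\<^sup>2) \<le> (1 - p) * (T * p * (1 - p) + (T * p - c)\<^sup>2)"
    using 3 by (intro mult_left_mono 3) auto
  have "1 - binomial_tail (Suc T) (Suc h) p = p * (1 - binomial_tail T h p) + (1 - p) * (1 - binomial_tail T (Suc h) p)"
    by (simp add: algebra_simps)
  then have "(1 - binomial_tail (Suc T) (Suc h) p) * (c - real (Suc h))\<^sup>2
    \<le> p * (T * p * (1 - p) + (T * p - (c - 1))\<^sup>2) + (1 - p) * (T * p * (1 - p) + (T * p - c)\<^sup>2)"
    using add_mono[OF A B] by (simp only: ring_distribs mult.assoc)
  also have "\<dots> = Suc T * p * (1 - p) + (Suc T * p - c)\<^sup>2"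
    by (simp add: algebra_simps power2_eq_square)
  finally show ?case .
qed

section \<open>From fingerprints to a simultaneous-message protocol\<close>

lemma density_m_pure:
  assumes "(\<Sum>i<d. (cmod (a i))\<^sup>2) = 1"
  shows "density_m d (\<lambda>i j. a i * cnj (a j))"
  unfolding density_m_def psd_m_iff psd_on_def
proof (intro conjI ballI allI)
  fix v
  have "quad {..<d} (\<lambda>i j. a i * cnj (a j)) v = (\<Sum>i<d. cnj (v i) * a i) * cnj (\<Sum>i<d. cnj (v i) * a i)"
    by (simp add: quad_def sum_product mult_ac)
  also have "\<dots> = of_real ((cmod (\<Sum>i<d. cnj (v i) * a i))\<^sup>2)"
    by (simp only: complex_norm_square)
  finally show "0 \<le> Re (quad {..<d} (\<lambda>i j. a i * cnj (a j)) v)" by simp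
next
  have "(\<Sum>i<d. a i * cnj (a i)) = of_real (\<Sum>i<d. (cmod (a i))\<^sup>2)"
    by (simp only: complex_norm_square of_real_sum)
  then show "(\<Sum>i<d. a i * cnj (a i)) = 1" using assms by simp
qed simp

text \<open>Each player sends \<open>T\<close> copies of a \<open>d\<close>-qubit fingerprint, hence
  the cost. The pure product state turns the trace in \<open>smp_accept_prob\<close> into a
  quadratic form, whose value is already a binomial tail.\<close>

lemma smp_protocol_of_fingerprints:
  fixes a b :: "bool list \<Rightarrow> nat \<Rightarrow> complex"
  assumes a: "\<And>x. length x = n \<Longrightarrow> (\<Sum>k<2^d. (cmod (a x k))\<^sup>2) = 1"
    and b: "\<And>y. length y = n \<Longrightarrow> (\<Sum>k<2^d. (cmod (b y k))\<^sup>2) = 1"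
    and f: "\<And>x y. length x = n \<Longrightarrow> length y = n \<Longrightarrow>
      (let t = binomial_tail T h ((1 + (cmod (\<Sum>k<2^d. cnj (a x k) * b y k))\<^sup>2) / 2)
       in if f x y then t \<ge> 2/3 else t \<le> 1/3)"
  shows "smp_protocol n f (2 * d * T)"
proof -
  let ?D = "2^d :: nat" and ?N = "2 ^ (d * T) :: nat"
  have N: "?D ^ T = ?N" by (simp add: power_mult)
  define A where "A x i j = copies ?D T (a x) i * cnj (copies ?D T (a x) j)" for x i j
  define B where "B y i j = copies ?D T (b y) i * cnj (copies ?D T (b y) j)" for y i j
  \<comment> \<open>As in \<open>kron_m\<close>, Alice's message is the low part of the index and
    Bob's the high part.\<close>
  define E where "E i j = threshold_test ?D T h (i mod ?N, i div ?N) (j mod ?N, j div ?N)" for i j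
  have N2: "(2::nat) ^ (d * T + d * T) = ?N * ?N" by (simp add: power_add)
  have bij: "bij_betw (\<lambda>i. (i mod ?N, i div ?N)) {..<2 ^ (d * T + d * T)} ({..<?D^T} \<times> {..<?D^T})"
    unfolding N N2 by (rule bij_betw_mod_div) simp
  have eff: "effect_m (2 ^ (d * T + d * T)) E"
    unfolding effect_m_iff E_def
    by (rule effect_on_reindex[OF bij]) (simp add: effect_threshold_test)
  have prob: "smp_accept_prob (d * T) (d * T) E (A x) (B y)
      = binomial_tail T h ((1 + (cmod (\<Sum>k<2^d. cnj (a x k) * b y k))\<^sup>2) / 2)"
    if "length x = n" "length y = n" for x y
  proof -
    have "smp_accept_prob (d * T) (d * T) E (A x) (B y) = Re (quad {..<2 ^ (d * T + d * T)} E
        (\<lambda>i. copies ?D T (a x) (i mod ?N) * copies ?D T (b y) (i div ?N)))"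
      by (simp add: smp_accept_prob_def quad_def kron_m_def A_def B_def mult_ac)
    also have "\<dots> = Re (quad ({..<?D^T} \<times> {..<?D^T}) (threshold_test ?D T h)
        (\<lambda>p. copies ?D T (a x) (fst p) * copies ?D T (b y) (snd p)))"
      unfolding E_def by (subst quad_reindex[OF bij, symmetric]) simp
    also have "\<dots> = binomial_tail T h ((1 + (cmod (\<Sum>k<2^d. cnj (a x k) * b y k))\<^sup>2) / 2)"
      by (subst quad_threshold_test) (simp_all add: a b that)
    finally show ?thesis .
  qed
  have dA: "density_m (2 ^ (d * T)) (A x)" if "length x = n" for x
    unfolding A_def using sum_norm_copies[of ?D "a x" T] a[OF that]
    by (intro density_m_pure) (simp add: N)
  have dB: "density_m (2 ^ (d * T)) (B y)" if "length y = n" for y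
    unfolding B_def using sum_norm_copies[of ?D "b y" T] b[OF that]
    by (intro density_m_pure) (simp add: N)
  have "if f x y then smp_accept_prob (d * T) (d * T) E (A x) (B y) \<ge> 2/3
      else smp_accept_prob (d * T) (d * T) E (A x) (B y) \<le> 1/3"
    if "length x = n" "length y = n" for x y
    using f[OF that] unfolding prob[OF that] Let_def .
  moreover have "d * T + d * T \<le> 2 * d * T" by simp
  ultimately show ?thesis
    unfolding smp_protocol_def using dA dB eff by blast
qed

section \<open>Yao's decomposition of two-party protocols\<close>

lemma bit_set_encode: "finite J \<Longrightarrow> bit (set_encode J) i \<longleftrightarrow> i \<in> J"
  by (metis bit_iff_odd mem_Collect_eq set_decode_def set_encode_inverse)

lemma bij_betw_set_encode: "bij_betw set_encode (Pow {..<N}) {..<2^N}"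
proof -
  have inj: "inj_on set_encode (Pow {..<N})"
    by (rule inj_on_subset[OF inj_on_set_encode]) (auto intro: finite_subset)
  have "set_encode J < 2^N" if "J \<subseteq> {..<N}" for J
  proof -
    have "set_encode J \<le> (\<Sum>i<N. 2^i)"
      unfolding set_encode_def using that by (intro sum_mono2) auto
    also have "\<dots> < 2^N" by (induction N) auto
    finally show ?thesis .
  qed
  then have "set_encode ` Pow {..<N} = {..<2^N}"
    by (intro card_subset_eq) (auto simp: card_image[OF inj] card_Pow)
  with inj show ?thesis by (simp add: bij_betw_def)
qed

lemma sum_set_encode:
  fixes g :: "nat \<Rightarrow> 'a :: comm_monoid_add"
  shows "(\<Sum>j<2^N. g j) = (\<Sum>J\<in>Pow {..<N}. g (set_encode J))"
  using sum.reindex_bij_betw[OF bij_betw_set_encode, of g N] by simp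

text \<open>With basis states as sets, this is the splitting of the state space into the tensor
  factors of the two owners.\<close>

lemma sum_Pow_Un:
  fixes g :: "'k set \<Rightarrow> 'a :: comm_monoid_add"
  assumes "A \<inter> B = {}"
  shows "(\<Sum>J\<in>Pow (A \<union> B). g J) = (\<Sum>P\<in>Pow A. \<Sum>Q\<in>Pow B. g (P \<union> Q))"
proof -
  have "bij_betw (\<lambda>(P, Q). P \<union> Q) (Pow A \<times> Pow B) (Pow (A \<union> B))"
    by (rule bij_betw_byWitness[where f' = "\<lambda>J. (J \<inter> A, J \<inter> B)"]) (use assms in auto)
  from sum.reindex_bij_betw[OF this, of g] show ?thesis
    by (simp add: sum.cartesian_product case_prod_unfold)
qed

text \<open>The index set is general because the lemma serves twice: for a unitary on all basis
  states, and for its block on the subsets of the speaker's qubits.\<close>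

lemma isometry_norm:
  assumes S: "finite S"
    and W: "\<And>s t. s \<in> S \<Longrightarrow> t \<in> S \<Longrightarrow> (\<Sum>k\<in>S. cnj (W k s) * W k t) = id_on s t"
  shows "(\<Sum>k\<in>S. (cmod (\<Sum>s\<in>S. W k s * v s))\<^sup>2) = (\<Sum>s\<in>S. (cmod (v s))\<^sup>2)"
proof -
  have sq: "of_real ((cmod z)\<^sup>2) = cnj z * z" for z
    by (subst mult.commute) (rule complex_norm_square)
  have "of_real (\<Sum>k\<in>S. (cmod (\<Sum>s\<in>S. W k s * v s))\<^sup>2)
      = (\<Sum>k\<in>S. (\<Sum>s\<in>S. cnj (W k s * v s)) * (\<Sum>t\<in>S. W k t * v t))"
    by (simp only: of_real_sum sq cnj_sum)
  also have "\<dots> = (\<Sum>k\<in>S. \<Sum>s\<in>S. \<Sum>t\<in>S. cnj (v s) * (cnj (W k s) * W k t) * v t)"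
    by (simp only: sum_product) (simp add: mult_ac)
  also have "\<dots> = (\<Sum>s\<in>S. \<Sum>k\<in>S. \<Sum>t\<in>S. cnj (v s) * (cnj (W k s) * W k t) * v t)"
    by (rule sum.swap)
  also have "\<dots> = (\<Sum>s\<in>S. \<Sum>t\<in>S. \<Sum>k\<in>S. cnj (v s) * (cnj (W k s) * W k t) * v t)"
    by (rule sum.cong[OF refl], rule sum.swap)
  also have "\<dots> = quad S id_on v"
    unfolding quad_def
    by (intro sum.cong refl) (simp add: sum_distrib_right[symmetric] sum_distrib_left[symmetric] W)
  also have "\<dots> = of_real (\<Sum>s\<in>S. (cmod (v s))\<^sup>2)"
    by (rule quad_id[OF S])
  finally show ?thesis using of_real_eq_iff by blast
qed

lemma run_rounds_norm:
  assumes "valid_rounds n N own rs" "length x = n" "length y = n"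
  shows "(\<Sum>j<2^N. (cmod (run_rounds N x y rs v j))\<^sup>2) = (\<Sum>j<2^N. (cmod (v j))\<^sup>2)"
  using assms
proof (induction rs arbitrary: own v)
  case Nil
  then show ?case by simp
next
  case (Cons r rs)
  obtain s U M where r: "r = (s, U, M)" by (cases r)
  have "unitary_m (2^N) (U (if s then x else y))" using Cons.prems by (auto simp: r)
  then have "(\<Sum>j<2^N. (cmod (apply_m (2^N) (U (if s then x else y)) v j))\<^sup>2) = (\<Sum>j<2^N. (cmod (v j))\<^sup>2)"
    unfolding apply_m_def by (intro isometry_norm) (auto simp: unitary_m_def id_m_def id_on_def)
  then show ?case using Cons by (auto simp: r)
qed

lemma prob_output_one_bounds:
  assumes "valid_qprotocol n p" "length x = n" "length y = n"
  shows "0 \<le> prob_output_one p x y" "prob_output_one p x y \<le> 1"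
proof -
  obtain N own rs out where p: "p = (N, own, rs, out)" by (cases p)
  let ?v = "run_rounds N x y rs init_state"
  show "0 \<le> prob_output_one p x y"
    by (auto simp: p prob_output_one_def intro!: sum_nonneg)
  have "prob_output_one p x y \<le> (\<Sum>j<2^N. (cmod (?v j))\<^sup>2)"
    by (auto simp: p prob_output_one_def intro!: sum_mono)
  also have "\<dots> = (\<Sum>j<2^N. (cmod (init_state j))\<^sup>2)"
    using assms by (intro run_rounds_norm) (auto simp: p valid_qprotocol_def)
  also have "\<dots> = (\<Sum>j<2^N. if j = (0::nat) then 1 else 0)"
    by (intro sum.cong) (auto simp: init_state_def)
  also have "\<dots> = 1" by simp
  finally show "prob_output_one p x y \<le> 1" .
qed

text \<open>Yao's decomposition: an amplitude is a sum, over the qubit strings m exchanged so far (one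
  list entry per round), of a product of a factor computable by Alice and one computable by Bob.
  Basis states are identified with the sets of qubits in state one; A and B are the qubits owned
  by the two players.\<close>

definition decomposes :: "nat \<Rightarrow> nat set \<Rightarrow> nat set \<Rightarrow> nat set list set \<Rightarrow>
    (nat set list \<Rightarrow> bool list \<Rightarrow> nat set \<Rightarrow> complex) \<Rightarrow>
    (nat set list \<Rightarrow> bool list \<Rightarrow> nat set \<Rightarrow> complex) \<Rightarrow>
    (bool list \<Rightarrow> bool list \<Rightarrow> cvec) \<Rightarrow> bool" where
  "decomposes n A B I \<alpha> \<beta> v \<longleftrightarrow> finite I \<and>
     (\<forall>m\<in>I. \<forall>x. length x = n \<longrightarrow> (\<Sum>P\<in>Pow A. (cmod (\<alpha> m x P))\<^sup>2) \<le> 1) \<and>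
     (\<forall>m\<in>I. \<forall>y. length y = n \<longrightarrow> (\<Sum>Q\<in>Pow B. (cmod (\<beta> m y Q))\<^sup>2) \<le> 1) \<and>
     (\<forall>x y. length x = n \<longrightarrow> length y = n \<longrightarrow> (\<forall>J\<in>Pow (A \<union> B).
        v x y (set_encode J) = (\<Sum>m\<in>I. \<alpha> m x (J \<inter> A) * \<beta> m y (J \<inter> B))))"

lemma decomposes_amplitude:
  "decomposes n A B I \<alpha> \<beta> v \<Longrightarrow> length x = n \<Longrightarrow> length y = n \<Longrightarrow> J \<in> Pow (A \<union> B) \<Longrightarrow>
     v x y (set_encode J) = (\<Sum>m\<in>I. \<alpha> m x (J \<inter> A) * \<beta> m y (J \<inter> B))"
  unfolding decomposes_def by blast

text \<open>Exchanging the players lets the lemmas on Alice's moves serve for Bob's.\<close>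

lemma decomposes_flip:
  "decomposes n A B I \<alpha> \<beta> v \<Longrightarrow> decomposes n B A I \<beta> \<alpha> (\<lambda>y x. v x y)"
  by (auto simp: decomposes_def Un_commute mult.commute)

text \<open>A unitary on Alice's qubits is block diagonal in Bob's, with the same block for each of
  their values. It therefore acts on Alice's factors alone, and the block is an isometry.\<close>

lemma decomposes_unitary:
  assumes AB: "A \<union> B = {..<N}" "A \<inter> B = {}"
    and U: "\<And>x. length x = n \<Longrightarrow> unitary_m (2^N) (U x) \<and> acts_on N A (U x)"
    and dec: "decomposes n A B I \<alpha> \<beta> v"
  shows "decomposes n A B I (\<lambda>m x P. \<Sum>Q\<in>Pow A. U x (set_encode P) (set_encode Q) * \<alpha> m x Q) \<beta>
    (\<lambda>x y. apply_m (2^N) (U x) (v x y))"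
proof -
  have finA: "finite A" "finite B" using AB(1) by (metis finite_Un finite_lessThan)+
  have fin: "finite J" if "J \<in> Pow {..<N}" for J using that finite_subset by auto
  have lt: "set_encode J < 2^N" if "J \<in> Pow {..<N}" for J
    using bij_betwE[OF bij_betw_set_encode] that by auto
  have A: "J \<in> Pow {..<N}" if "J \<subseteq> A" for J using that AB by auto
  have zero: "U x (set_encode J) (set_encode K) = 0"
    if x: "length x = n" and J: "J \<in> Pow {..<N}" and K: "K \<in> Pow {..<N}" and JK: "J \<inter> B \<noteq> K \<inter> B" for x J K
  proof -
    from JK obtain i where i: "i \<in> B" "(i \<in> J) \<noteq> (i \<in> K)" by blast
    then have "i < N" "i \<notin> A" using AB by auto
    then show ?thesis
      using i U[OF x] lt[OF J] lt[OF K] bit_set_encode[OF fin[OF J]] bit_set_encode[OF fin[OF K]]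
      unfolding acts_on_def by meson
  qed
  have local: "U x (set_encode J) (set_encode (Q \<union> (J \<inter> B))) = U x (set_encode (J \<inter> A)) (set_encode Q)"
    if x: "length x = n" and J: "J \<in> Pow {..<N}" and Q: "Q \<in> Pow A" for x J Q
  proof -
    have s: "Q \<union> (J \<inter> B) \<in> Pow {..<N}" "J \<inter> A \<in> Pow {..<N}" "Q \<in> Pow {..<N}"
      using J Q AB by auto
    have "\<forall>i\<in>A. bit (set_encode J) i = bit (set_encode (J \<inter> A)) i
        \<and> bit (set_encode (Q \<union> (J \<inter> B))) i = bit (set_encode Q) i"
      "\<forall>i<N. i \<notin> A \<longrightarrow> bit (set_encode J) i = bit (set_encode (Q \<union> (J \<inter> B))) i"
      "\<forall>i<N. i \<notin> A \<longrightarrow> bit (set_encode (J \<inter> A)) i = bit (set_encode Q) i"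
      using AB Q unfolding bit_set_encode[OF fin[OF J]] bit_set_encode[OF fin[OF s(1)]]
        bit_set_encode[OF fin[OF s(2)]] bit_set_encode[OF fin[OF s(3)]]
      by auto
    then show ?thesis
      using U[OF x] lt[OF J] lt[OF s(1)] lt[OF s(2)] lt[OF s(3)] unfolding acts_on_def by blast
  qed
  have norm: "(\<Sum>P\<in>Pow A. (cmod (\<Sum>Q\<in>Pow A. U x (set_encode P) (set_encode Q) * \<alpha> m x Q))\<^sup>2) \<le> 1"
    if "m \<in> I" and x: "length x = n" for m x
  proof -
    have "(\<Sum>P\<in>Pow A. cnj (U x (set_encode P) (set_encode Q)) * U x (set_encode P) (set_encode Q')) = id_on Q Q'"
      if Q: "Q \<in> Pow A" "Q' \<in> Pow A" for Q Q'
    proof -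
      have s: "Q \<in> Pow {..<N}" "Q' \<in> Pow {..<N}" using Q A by auto
      \<comment> \<open>A column indexed by a subset of \<open>A\<close> vanishes in every row that
        contains a qubit of \<open>B\<close>, so the block inherits orthonormal columns from the
        whole matrix.\<close>
      have "(\<Sum>P\<in>Pow A. cnj (U x (set_encode P) (set_encode Q)) * U x (set_encode P) (set_encode Q'))
        = (\<Sum>P\<in>Pow {..<N}. cnj (U x (set_encode P) (set_encode Q)) * U x (set_encode P) (set_encode Q'))"
      proof (rule sum.mono_neutral_left)
        show "\<forall>P\<in>Pow {..<N} - Pow A. cnj (U x (set_encode P) (set_encode Q)) * U x (set_encode P) (set_encode Q') = 0"
        proof
          fix P assume P: "P \<in> Pow {..<N} - Pow A"
          then have "P \<inter> B \<noteq> Q \<inter> B" using Q AB by blast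
          then show "cnj (U x (set_encode P) (set_encode Q)) * U x (set_encode P) (set_encode Q') = 0"
            using zero[OF x _ s(1)] P by auto
        qed
      qed (use A in auto)
      also have "\<dots> = (\<Sum>j<2^N. cnj (U x j (set_encode Q)) * U x j (set_encode Q'))"
        by (rule sum_set_encode[symmetric])
      also have "\<dots> = id_m (set_encode Q) (set_encode Q')"
        using U[OF x] lt[OF s(1)] lt[OF s(2)] by (auto simp: unitary_m_def)
      also have "\<dots> = id_on Q Q'"
        using set_encode_eq[OF fin[OF s(1)] fin[OF s(2)]] by (simp add: id_m_def id_on_def)
      finally show ?thesis .
    qed
    then have "(\<Sum>P\<in>Pow A. (cmod (\<Sum>Q\<in>Pow A. U x (set_encode P) (set_encode Q) * \<alpha> m x Q))\<^sup>2)
       = (\<Sum>Q\<in>Pow A. (cmod (\<alpha> m x Q))\<^sup>2)"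
      using finA by (intro isometry_norm) auto
    then show ?thesis using dec that by (auto simp: decomposes_def)
  qed
  have amplitude: "apply_m (2^N) (U x) (v x y) (set_encode J)
      = (\<Sum>m\<in>I. (\<Sum>Q\<in>Pow A. U x (set_encode (J \<inter> A)) (set_encode Q) * \<alpha> m x Q) * \<beta> m y (J \<inter> B))"
    if x: "length x = n" and y: "length y = n" and J: "J \<in> Pow (A \<union> B)" for x y J
  proof -
    have J': "J \<in> Pow {..<N}" using J AB by simp
    have "apply_m (2^N) (U x) (v x y) (set_encode J)
       = (\<Sum>K\<in>Pow (A \<union> B). U x (set_encode J) (set_encode K) * v x y (set_encode K))"
      unfolding apply_m_def AB(1) by (rule sum_set_encode)
    also have "\<dots> = (\<Sum>Q\<in>Pow A. \<Sum>R\<in>Pow B. U x (set_encode J) (set_encode (Q \<union> R)) * v x y (set_encode (Q \<union> R)))"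
      by (rule sum_Pow_Un[OF AB(2)])
    \<comment> \<open>Of Bob's configurations only the unchanged one, \<open>J \<inter> B\<close>,
      contributes, and the matrix entry there does not depend on it.\<close>
    also have "\<dots> = (\<Sum>Q\<in>Pow A. U x (set_encode (J \<inter> A)) (set_encode Q) * v x y (set_encode (Q \<union> (J \<inter> B))))"
    proof (rule sum.cong[OF refl])
      fix Q assume Q: "Q \<in> Pow A"
      have "(\<Sum>R\<in>Pow B. U x (set_encode J) (set_encode (Q \<union> R)) * v x y (set_encode (Q \<union> R)))
        = (\<Sum>R\<in>Pow B. if R = J \<inter> B then U x (set_encode J) (set_encode (Q \<union> R)) * v x y (set_encode (Q \<union> R)) else 0)"
      proof (rule sum.cong[OF refl])
        fix R assume R: "R \<in> Pow B"
        have "U x (set_encode J) (set_encode (Q \<union> R)) = 0" if "R \<noteq> J \<inter> B"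
        proof (rule zero[OF x J'])
          show "Q \<union> R \<in> Pow {..<N}" using Q R AB by auto
          show "J \<inter> B \<noteq> (Q \<union> R) \<inter> B" using that Q R AB by auto
        qed
        then show "U x (set_encode J) (set_encode (Q \<union> R)) * v x y (set_encode (Q \<union> R))
          = (if R = J \<inter> B then U x (set_encode J) (set_encode (Q \<union> R)) * v x y (set_encode (Q \<union> R)) else 0)"
          by auto
      qed
      also have "\<dots> = U x (set_encode J) (set_encode (Q \<union> (J \<inter> B))) * v x y (set_encode (Q \<union> (J \<inter> B)))"
        using finA by (subst sum.delta) auto
      finally show "(\<Sum>R\<in>Pow B. U x (set_encode J) (set_encode (Q \<union> R)) * v x y (set_encode (Q \<union> R)))
        = U x (set_encode (J \<inter> A)) (set_encode Q) * v x y (set_encode (Q \<union> (J \<inter> B)))"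
        unfolding local[OF x J' Q] .
    qed
    also have "\<dots> = (\<Sum>Q\<in>Pow A. U x (set_encode (J \<inter> A)) (set_encode Q) * (\<Sum>m\<in>I. \<alpha> m x Q * \<beta> m y (J \<inter> B)))"
    proof (rule sum.cong[OF refl])
      fix Q assume Q: "Q \<in> Pow A"
      have e: "(Q \<union> (J \<inter> B)) \<inter> A = Q" "(Q \<union> (J \<inter> B)) \<inter> B = J \<inter> B" using Q AB by auto
      have "Q \<union> (J \<inter> B) \<in> Pow (A \<union> B)" using Q by auto
      then have "v x y (set_encode (Q \<union> (J \<inter> B))) = (\<Sum>m\<in>I. \<alpha> m x Q * \<beta> m y (J \<inter> B))"
        using decomposes_amplitude[OF dec x y, of "Q \<union> (J \<inter> B)"] unfolding e by blast
      then show "U x (set_encode (J \<inter> A)) (set_encode Q) * v x y (set_encode (Q \<union> (J \<inter> B)))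
        = U x (set_encode (J \<inter> A)) (set_encode Q) * (\<Sum>m\<in>I. \<alpha> m x Q * \<beta> m y (J \<inter> B))" by simp
    qed
    also have "\<dots> = (\<Sum>m\<in>I. (\<Sum>Q\<in>Pow A. U x (set_encode (J \<inter> A)) (set_encode Q) * \<alpha> m x Q) * \<beta> m y (J \<inter> B))"
      by (simp only: sum_distrib_left sum_distrib_right mult.assoc) (rule sum.swap)
    finally show ?thesis .
  qed
  have "finite I" "\<And>m y. m \<in> I \<Longrightarrow> length y = n \<Longrightarrow> (\<Sum>Q\<in>Pow B. (cmod (\<beta> m y Q))\<^sup>2) \<le> 1"
    using dec unfolding decomposes_def by auto
  then show ?thesis
    unfolding decomposes_def by (intro conjI ballI allI impI norm amplitude)
qed

text \<open>Sending the qubits M: branch on their values \<mu>, which Alice hard-wires and Bob checks.\<close>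

lemma decomposes_send:
  assumes AB: "A \<inter> B = {}" "finite A" "finite B" and M: "M \<subseteq> A"
    and dec: "decomposes n A B I \<alpha> \<beta> v"
  obtains I' \<alpha>' \<beta>' where "decomposes n (A - M) (B \<union> M) I' \<alpha>' \<beta>' v" "card I' = 2 ^ card M * card I"
proof
  define I' where "I' = (\<lambda>(\<mu>, m). \<mu> # m) ` (Pow M \<times> I)"
  define \<alpha>' where "\<alpha>' m x P = \<alpha> (tl m) x (P \<union> hd m)" for m x P
  define \<beta>' where "\<beta>' m y Q = (if Q \<inter> M = hd m then \<beta> (tl m) y (Q \<inter> B) else 0)" for m y Q
  have finM: "finite M" using M AB finite_subset by auto
  have inj: "inj_on (\<lambda>(\<mu>, m). \<mu> # m) (Pow M \<times> I)" by (auto simp: inj_on_def)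
  show "card I' = 2 ^ card M * card I"
    unfolding I'_def by (simp add: card_image[OF inj] card_cartesian_product card_Pow[OF finM])
  have sum_I': "(\<Sum>m\<in>I'. g m) = (\<Sum>\<mu>\<in>Pow M. \<Sum>m\<in>I. g (\<mu> # m))" for g :: "nat set list \<Rightarrow> complex"
    unfolding I'_def sum.cartesian_product sum.reindex[OF inj] by (rule sum.cong) auto
  have "(\<Sum>P\<in>Pow (A - M). (cmod (\<alpha>' m x P))\<^sup>2) \<le> 1" if m: "m \<in> I'" and x: "length x = n" for m x
  proof -
    obtain \<mu> m' where m': "m = \<mu> # m'" "\<mu> \<subseteq> M" "m' \<in> I" using m by (auto simp: I'_def)
    have i: "inj_on (\<lambda>P. P \<union> \<mu>) (Pow (A - M))" using m' by (auto simp: inj_on_def)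
    have "(\<Sum>P\<in>Pow (A - M). (cmod (\<alpha>' m x P))\<^sup>2) = (\<Sum>P\<in>(\<lambda>P. P \<union> \<mu>) ` Pow (A - M). (cmod (\<alpha> m' x P))\<^sup>2)"
      by (simp add: sum.reindex[OF i] \<alpha>'_def m')
    also have "\<dots> \<le> (\<Sum>P\<in>Pow A. (cmod (\<alpha> m' x P))\<^sup>2)"
      using AB m' M by (intro sum_mono2) auto
    also have "\<dots> \<le> 1" using dec m' x by (simp add: decomposes_def)
    finally show ?thesis .
  qed
  moreover have "(\<Sum>Q\<in>Pow (B \<union> M). (cmod (\<beta>' m y Q))\<^sup>2) \<le> 1" if m: "m \<in> I'" and y: "length y = n" for m y
  proof -
    obtain \<mu> m' where m': "m = \<mu> # m'" "\<mu> \<subseteq> M" "m' \<in> I" using m by (auto simp: I'_def)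
    \<comment> \<open>Once the received qubits are fixed to \<open>\<mu>\<close>, \<open>Q\<close>
      is determined by \<open>Q \<inter> B\<close>, so the sum does not exceed the old one.\<close>
    let ?Q = "{Q \<in> Pow (B \<union> M). Q \<inter> M = \<mu>}"
    have i: "inj_on (\<lambda>Q. Q \<inter> B) ?Q" by (auto simp: inj_on_def)
    have "(\<Sum>Q\<in>Pow (B \<union> M). (cmod (\<beta>' m y Q))\<^sup>2) = (\<Sum>Q\<in>?Q. (cmod (\<beta> m' y (Q \<inter> B)))\<^sup>2)"
      using AB finM by (intro sum.mono_neutral_cong_right) (auto simp: \<beta>'_def m')
    also have "\<dots> = (\<Sum>Q\<in>(\<lambda>Q. Q \<inter> B) ` ?Q. (cmod (\<beta> m' y Q))\<^sup>2)"
      unfolding sum.reindex[OF i] by simp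
    also have "\<dots> \<le> (\<Sum>Q\<in>Pow B. (cmod (\<beta> m' y Q))\<^sup>2)"
      using AB by (intro sum_mono2) auto
    also have "\<dots> \<le> 1" using dec m' y by (simp add: decomposes_def)
    finally show ?thesis .
  qed
  moreover have "v x y (set_encode J) = (\<Sum>m\<in>I'. \<alpha>' m x (J \<inter> (A - M)) * \<beta>' m y (J \<inter> (B \<union> M)))"
    if x: "length x = n" and y: "length y = n" and J: "J \<in> Pow ((A - M) \<union> (B \<union> M))" for x y J
  proof -
    have e: "J \<inter> (B \<union> M) \<inter> M = J \<inter> M" "J \<inter> (B \<union> M) \<inter> B = J \<inter> B" "J \<inter> (A - M) \<union> (J \<inter> M) = J \<inter> A"
      using M by auto
    \<comment> \<open>Exactly one message value, \<open>J \<inter> M\<close>, passes Bob's check,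
      and it restores Alice's old argument.\<close>
    have "(\<Sum>m\<in>I'. \<alpha>' m x (J \<inter> (A - M)) * \<beta>' m y (J \<inter> (B \<union> M)))
      = (\<Sum>\<mu>\<in>Pow M. if \<mu> = J \<inter> M then (\<Sum>m\<in>I. \<alpha> m x (J \<inter> (A - M) \<union> \<mu>) * \<beta> m y (J \<inter> B)) else 0)"
      unfolding sum_I' \<alpha>'_def \<beta>'_def e by (intro sum.cong refl) auto
    also have "\<dots> = (\<Sum>m\<in>I. \<alpha> m x (J \<inter> A) * \<beta> m y (J \<inter> B))"
      using finM by (subst sum.delta) (auto simp: e)
    also have "\<dots> = v x y (set_encode J)"
      by (rule decomposes_amplitude[OF dec x y, symmetric]) (use J M in auto)
    finally show ?thesis by simp
  qed
  moreover have "finite I'" using dec finM by (simp add: I'_def decomposes_def)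
  ultimately show "decomposes n (A - M) (B \<union> M) I' \<alpha>' \<beta>' v"
    unfolding decomposes_def by simp
qed

text \<open>Local unitaries keep the number of terms, and sending \<open>M\<close> multiplies it by
  \<open>2 ^ card M\<close>; over all rounds the exponents add up to the communication cost.\<close>

lemma decomposes_run_rounds:
  assumes "valid_rounds n N own rs"
    and "decomposes n {i. i < N \<and> own i} {i. i < N \<and> \<not> own i} I \<alpha> \<beta> v"
  shows "\<exists>A B I' \<alpha>' \<beta>'. A \<union> B = {..<N} \<and> A \<inter> B = {} \<and> card I' = card I * 2 ^ comm_cost rs \<and>
    decomposes n A B I' \<alpha>' \<beta>' (\<lambda>x y. run_rounds N x y rs (v x y))"
  using assms
proof (induction rs arbitrary: own I \<alpha> \<beta> v)
  case Nil
  let ?A = "{i. i < N \<and> own i}" and ?B = "{i. i < N \<and> \<not> own i}"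
  have "?A \<union> ?B = {..<N}" "?A \<inter> ?B = {}" by auto
  then show ?case using Nil(2)
    by (intro exI[of _ ?A] exI[of _ ?B] exI[of _ I] exI[of _ \<alpha>] exI[of _ \<beta>]) simp
next
  case (Cons r rs)
  obtain s U M where r: "r = (s, U, M)" by (cases r)
  let ?A = "{i. i < N \<and> own i}" and ?B = "{i. i < N \<and> \<not> own i}"
  let ?own = "\<lambda>i. if i \<in> M then \<not> s else own i"
  let ?v = "\<lambda>x y. apply_m (2^N) (U (if s then x else y)) (v x y)"
  have AB: "?A \<union> ?B = {..<N}" "?A \<inter> ?B = {}" and BA: "?B \<union> ?A = {..<N}" "?B \<inter> ?A = {}" by auto
  have fin: "finite ?A" "finite ?B" by simp_all
  have val: "valid_rounds n N ?own rs" using Cons.prems by (simp add: r)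
  have "\<exists>I' \<alpha>' \<beta>'. decomposes n {i. i < N \<and> ?own i} {i. i < N \<and> \<not> ?own i} I' \<alpha>' \<beta>' ?v
      \<and> card I' = 2 ^ card M * card I"
  proof (cases s)
    case True
    have M: "M \<subseteq> ?A" and U: "\<And>x. length x = n \<Longrightarrow> unitary_m (2^N) (U x) \<and> acts_on N ?A (U x)"
      using Cons.prems True by (auto simp: r)
    have e: "{i. i < N \<and> ?own i} = ?A - M" "{i. i < N \<and> \<not> ?own i} = ?B \<union> M"
      using M True by auto
    have dec: "decomposes n ?A ?B I \<alpha> \<beta> v" using Cons.prems by simp
    obtain I' \<alpha>' \<beta>' where *: "decomposes n (?A - M) (?B \<union> M) I' \<alpha>' \<beta>' (\<lambda>x y. apply_m (2^N) (U x) (v x y))"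
        "card I' = 2 ^ card M * card I"
      by (rule decomposes_send[OF AB(2) fin M decomposes_unitary[OF AB U dec]]) blast
    show ?thesis
      unfolding e using * True by auto
  next
    case False
    have M: "M \<subseteq> ?B" and U: "\<And>x. length x = n \<Longrightarrow> unitary_m (2^N) (U x) \<and> acts_on N ?B (U x)"
      using Cons.prems False by (auto simp: r)
    have e: "{i. i < N \<and> ?own i} = ?A \<union> M" "{i. i < N \<and> \<not> ?own i} = ?B - M"
      using M False by auto
    have dec: "decomposes n ?A ?B I \<alpha> \<beta> v" using Cons.prems by simp
    obtain I' \<alpha>' \<beta>' where *: "decomposes n (?B - M) (?A \<union> M) I' \<alpha>' \<beta>' (\<lambda>y x. apply_m (2^N) (U y) (v x y))"
        "card I' = 2 ^ card M * card I"
      by (rule decomposes_send[OF BA(2) fin(2,1) M decomposes_unitary[OF BA U decomposes_flip[OF dec]]]) blast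
    show ?thesis
      unfolding e using decomposes_flip[OF *(1)] *(2) False by auto
  qed
  then obtain I' \<alpha>' \<beta>' where *: "decomposes n {i. i < N \<and> ?own i} {i. i < N \<and> \<not> ?own i} I' \<alpha>' \<beta>' ?v"
      "card I' = 2 ^ card M * card I" by blast
  from Cons.IH[OF val *(1)] *(2) show ?case
    by (simp add: r power_add mult_ac)
qed

section \<open>From amplitudes to acceptance probabilities\<close>

lemma norm_sum_mult_cnj_le:
  assumes "(\<Sum>P\<in>S. (cmod (a P))\<^sup>2) \<le> 1" "(\<Sum>P\<in>S. (cmod (b P))\<^sup>2) \<le> 1"
  shows "cmod (\<Sum>P\<in>S. of_bool (g P) * (a P * cnj (b P))) \<le> 1"
proof -
  have "cmod (\<Sum>P\<in>S. of_bool (g P) * (a P * cnj (b P))) \<le> (\<Sum>P\<in>S. ((cmod (a P))\<^sup>2 + (cmod (b P))\<^sup>2) / 2)"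
  proof (rule sum_norm_le)
    fix P
    have "0 \<le> (cmod (a P) - cmod (b P))\<^sup>2" by simp
    then have "cmod (a P) * cmod (b P) \<le> ((cmod (a P))\<^sup>2 + (cmod (b P))\<^sup>2) / 2"
      by (simp add: power2_diff)
    moreover have "0 \<le> cmod (a P) * cmod (b P)" by simp
    ultimately show "cmod (of_bool (g P) * (a P * cnj (b P))) \<le> ((cmod (a P))\<^sup>2 + (cmod (b P))\<^sup>2) / 2"
      by (cases "g P") (auto simp: norm_mult)
  qed
  also have "\<dots> \<le> 1"
    using assms by (simp add: sum_divide_distrib[symmetric] sum.distrib)
  finally show ?thesis .
qed

text \<open>Squaring the amplitude doubles the summation index: at most \<open>2^q * 2^q\<close>
  pairs of transcripts, each contributing factors of modulus at most one. This gives both the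
  dimension and the bound on the squared norms.\<close>

lemma prob_output_one_inner_product:
  assumes val: "valid_qprotocol n p" and cost: "qprotocol_cost p \<le> q"
  shows "\<exists>u v :: bool list \<Rightarrow> nat \<Rightarrow> complex.
    (\<forall>x. length x = n \<longrightarrow> (\<Sum>l<4^q. (cmod (u x l))\<^sup>2) \<le> 4^q) \<and>
    (\<forall>y. length y = n \<longrightarrow> (\<Sum>l<4^q. (cmod (v y l))\<^sup>2) \<le> 4^q) \<and>
    (\<forall>x y. length x = n \<longrightarrow> length y = n \<longrightarrow>
       of_real (prob_output_one p x y) = (\<Sum>l<4^q. u x l * v y l))"
proof -
  obtain N own rs out where p: "p = (N, own, rs, out)" by (cases p)
  have out: "out < N" and rs: "valid_rounds n N own rs" and c: "comm_cost rs \<le> q"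
    using val cost by (auto simp: p valid_qprotocol_def qprotocol_cost_def)
  \<comment> \<open>Before any message the only transcript is the empty list, and the all-zero state
    is a product across the two owners.\<close>
  define \<delta> :: "nat set list \<Rightarrow> bool list \<Rightarrow> nat set \<Rightarrow> complex"
    where "\<delta> m x P = of_bool (P = {})" for m x P
  have "decomposes n {i. i < N \<and> own i} {i. i < N \<and> \<not> own i} {[]} \<delta> \<delta> (\<lambda>x y. init_state)"
  proof -
    have d: "(\<Sum>P\<in>Pow A. (cmod (\<delta> m x P))\<^sup>2) \<le> 1" if "finite A" for A m x
    proof -
      have "(\<Sum>P\<in>Pow A. (cmod (\<delta> m x P))\<^sup>2) = (\<Sum>P\<in>Pow A. if P = {} then 1 else 0)"
        by (intro sum.cong) (auto simp: \<delta>_def)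
      then show ?thesis using that by simp
    qed
    have "init_state (set_encode J) = \<delta> m x (J \<inter> {i. i < N \<and> own i}) * \<delta> m y (J \<inter> {i. i < N \<and> \<not> own i})"
      if "J \<in> Pow ({i. i < N \<and> own i} \<union> {i. i < N \<and> \<not> own i})" for J m x y
    proof -
      have "finite J" by (rule finite_subset[of _ "{..<N}"]) (use that in auto)
      then have "set_encode J = 0 \<longleftrightarrow> J = {}"
        using set_encode_eq[of J "{}"] by simp
      moreover have "J = {} \<longleftrightarrow> J \<inter> {i. i < N \<and> own i} = {} \<and> J \<inter> {i. i < N \<and> \<not> own i} = {}"
        using that by auto
      ultimately show ?thesis by (auto simp: init_state_def \<delta>_def)
    qed
    then show ?thesis using d unfolding decomposes_def by simp
  qed
  from decomposes_run_rounds[OF rs this] obtain A B I \<alpha> \<beta> where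
    AB: "A \<union> B = {..<N}" "A \<inter> B = {}" and cI: "card I = 2 ^ comm_cost rs"
    and dec: "decomposes n A B I \<alpha> \<beta> (\<lambda>x y. run_rounds N x y rs init_state)"
    by auto
  have finI: "finite I" using dec by (simp add: decomposes_def)
  \<comment> \<open>The output qubit belongs to exactly one player at the end. The implication makes
    the measurement a condition on that player's sum and leaves the other sum unrestricted.\<close>
  define u where "u x = (\<lambda>(m, m'). \<Sum>P\<in>Pow A. of_bool (out \<in> A \<longrightarrow> out \<in> P) * (\<alpha> m x P * cnj (\<alpha> m' x P)))" for x
  define w where "w y = (\<lambda>(m, m'). \<Sum>Q\<in>Pow B. of_bool (out \<in> B \<longrightarrow> out \<in> Q) * (\<beta> m y Q * cnj (\<beta> m' y Q)))" for y
  have u: "cmod (u x m) \<le> 1" if "length x = n" "m \<in> I \<times> I" for x m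
    using that dec norm_sum_mult_cnj_le[of "\<alpha> (fst m) x" "Pow A" "\<alpha> (snd m) x" "\<lambda>P. out \<in> A \<longrightarrow> out \<in> P"]
    by (auto simp: u_def decomposes_def case_prod_unfold)
  have w: "cmod (w y m) \<le> 1" if "length y = n" "m \<in> I \<times> I" for y m
    using that dec norm_sum_mult_cnj_le[of "\<beta> (fst m) y" "Pow B" "\<beta> (snd m) y" "\<lambda>Q. out \<in> B \<longrightarrow> out \<in> Q"]
    by (auto simp: w_def decomposes_def case_prod_unfold)
  have prob: "of_real (prob_output_one p x y) = (\<Sum>m\<in>I \<times> I. u x m * w y m)"
    if x: "length x = n" and y: "length y = n" for x y
  proof -
    let ?v = "run_rounds N x y rs init_state"
    have "prob_output_one p x y = (\<Sum>P\<in>Pow A. \<Sum>Q\<in>Pow B.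
        if bit (set_encode (P \<union> Q)) out then (cmod (?v (set_encode (P \<union> Q))))\<^sup>2 else 0)"
      unfolding p prob_output_one_def
      using sum_set_encode[of "\<lambda>j. if bit j out then (cmod (?v j))\<^sup>2 else 0" N]
        sum_Pow_Un[OF AB(2), of "\<lambda>J. if bit (set_encode J) out then (cmod (?v (set_encode J)))\<^sup>2 else 0"] AB(1)
      by simp
    then have "of_real (prob_output_one p x y) = (\<Sum>P\<in>Pow A. \<Sum>Q\<in>Pow B.
        of_real (if bit (set_encode (P \<union> Q)) out then (cmod (?v (set_encode (P \<union> Q))))\<^sup>2 else 0))"
      by (simp only: of_real_sum)
    also have "\<dots> = (\<Sum>P\<in>Pow A. \<Sum>Q\<in>Pow B. \<Sum>(m, m')\<in>I \<times> I.
        (of_bool (out \<in> A \<longrightarrow> out \<in> P) * (\<alpha> m x P * cnj (\<alpha> m' x P))) *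
        (of_bool (out \<in> B \<longrightarrow> out \<in> Q) * (\<beta> m y Q * cnj (\<beta> m' y Q))))"
    proof (intro sum.cong refl)
      fix P Q assume P: "P \<in> Pow A" and Q: "Q \<in> Pow B"
      have e: "(P \<union> Q) \<inter> A = P" "(P \<union> Q) \<inter> B = Q" using P Q AB by auto
      have PQ: "P \<union> Q \<in> Pow (A \<union> B)" using P Q by auto
      then have v: "?v (set_encode (P \<union> Q)) = (\<Sum>m\<in>I. \<alpha> m x P * \<beta> m y Q)"
        using decomposes_amplitude[OF dec x y, of "P \<union> Q"] unfolding e by blast
      have "finite (P \<union> Q)" using PQ unfolding AB(1) by (metis PowD finite_lessThan finite_subset)
      then have b: "bit (set_encode (P \<union> Q)) out \<longleftrightarrow> (out \<in> A \<longrightarrow> out \<in> P) \<and> (out \<in> B \<longrightarrow> out \<in> Q)"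
        using bit_set_encode[of "P \<union> Q" out] P Q AB out by auto
      have "of_real ((cmod (?v (set_encode (P \<union> Q))))\<^sup>2)
        = (\<Sum>(m, m')\<in>I \<times> I. (\<alpha> m x P * cnj (\<alpha> m' x P)) * (\<beta> m y Q * cnj (\<beta> m' y Q)))"
        unfolding complex_norm_square v
        unfolding cnj_sum sum_product sum.cartesian_product
        by (rule sum.cong) (simp_all add: case_prod_unfold mult_ac)
      then show "of_real (if bit (set_encode (P \<union> Q)) out then (cmod (?v (set_encode (P \<union> Q))))\<^sup>2 else 0)
        = (\<Sum>(m, m')\<in>I \<times> I. (of_bool (out \<in> A \<longrightarrow> out \<in> P) * (\<alpha> m x P * cnj (\<alpha> m' x P))) *
           (of_bool (out \<in> B \<longrightarrow> out \<in> Q) * (\<beta> m y Q * cnj (\<beta> m' y Q))))"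
        using b by (auto simp: case_prod_unfold)
    qed
    also have "\<dots> = (\<Sum>m\<in>I \<times> I. \<Sum>P\<in>Pow A. \<Sum>Q\<in>Pow B.
        (of_bool (out \<in> A \<longrightarrow> out \<in> P) * (\<alpha> (fst m) x P * cnj (\<alpha> (snd m) x P))) *
        (of_bool (out \<in> B \<longrightarrow> out \<in> Q) * (\<beta> (fst m) y Q * cnj (\<beta> (snd m) y Q))))"
      unfolding case_prod_unfold
      by (rule trans[OF _ sum.swap], rule sum.cong[OF refl], rule sum.swap)
    also have "\<dots> = (\<Sum>m\<in>I \<times> I. u x m * w y m)"
      by (simp only: u_def w_def sum_product case_prod_unfold)
    finally show ?thesis .
  qed
  have "card (I \<times> I) \<le> 4^q"
  proof -
    have "card (I \<times> I) = 4 ^ comm_cost rs"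
      by (simp add: card_cartesian_product cI flip: power_mult_distrib)
    then show ?thesis using c by (simp add: power_increasing)
  qed
  moreover obtain h where h: "bij_betw h {0..<card (I \<times> I)} (I \<times> I)"
    using ex_bij_betw_nat_finite[of "I \<times> I"] finI by auto
  ultimately have sum_h: "(\<Sum>l<4^q. if l < card (I \<times> I) then g (h l) else 0) = (\<Sum>m\<in>I \<times> I. g m)"
    for g :: "_ \<Rightarrow> complex"
  proof -
    have "{l. l < 4^q \<and> l < card (I \<times> I)} = {0..<card (I \<times> I)}"
      using \<open>card (I \<times> I) \<le> 4^q\<close> by auto
    then have "(\<Sum>l<4^q. if l < card (I \<times> I) then g (h l) else 0) = (\<Sum>l\<in>{0..<card (I \<times> I)}. g (h l))"
      by (simp add: sum.If_cases Int_def)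
    then show ?thesis using sum.reindex_bij_betw[OF h, of g] by simp
  qed
  \<comment> \<open>Padding with zeros up to \<open>4^q\<close>: cheaper protocols have fewer pairs,
    and all seeds have to share one dimension.\<close>
  define u' where "u' x l = (if l < card (I \<times> I) then u x (h l) else 0)" for x l
  define w' where "w' y l = (if l < card (I \<times> I) then w y (h l) else 0)" for y l
  have hI: "h l \<in> I \<times> I" if "l < card (I \<times> I)" for l
    using bij_betwE[OF h] that by auto
  have "(\<Sum>l<4^q. (cmod (u' x l))\<^sup>2) \<le> (\<Sum>l<(4::nat)^q. 1)" if "length x = n" for x
    using u[OF that hI] by (intro sum_mono) (auto simp: u'_def power_le_one)
  moreover have "(\<Sum>l<4^q. (cmod (w' y l))\<^sup>2) \<le> (\<Sum>l<(4::nat)^q. 1)" if "length y = n" for y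
    using w[OF that hI] by (intro sum_mono) (auto simp: w'_def power_le_one)
  moreover have "of_real (prob_output_one p x y) = (\<Sum>l<4^q. u' x l * w' y l)"
    if "length x = n" "length y = n" for x y
    unfolding prob[OF that] sum_h[of "\<lambda>m. u x m * w y m", symmetric]
    by (intro sum.cong refl) (simp add: u'_def w'_def)
  ultimately show ?thesis by (intro exI[of _ u'] exI[of _ w']) simp
qed

section \<open>Trivial protocols\<close>

lemma bij_betw_bool_lists: "\<exists>h. bij_betw h {x :: bool list. length x = n} {..<2^n :: nat}"
proof (rule finite_same_card_bij)
  show "finite {x :: bool list. length x = n}"
    using finite_lists_length_eq[of "UNIV :: bool set" n] by simp
  show "card {x :: bool list. length x = n} = card {..<2^n :: nat}"
    using card_lists_length_eq[of "UNIV :: bool set" n] by simp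
qed simp

lemma psd_on_diagonal:
  assumes "finite S" "\<And>s. 0 \<le> g s"
  shows "psd_on S (\<lambda>s t. if s = t then of_real (g s) else 0)"
  unfolding psd_on_def
proof (intro conjI ballI allI)
  fix v
  have "quad S (\<lambda>s t. if s = t then of_real (g s) else 0) v = (\<Sum>s\<in>S. of_real (g s) * (v s * cnj (v s)))"
    using assms(1) by (simp add: quad_def if_distrib[of "\<lambda>z. _ * z"] if_distrib[of "\<lambda>z. z * _"]
        sum.delta mult_ac cong: if_cong)
  also have "\<dots> = of_real (\<Sum>s\<in>S. g s * (cmod (v s))\<^sup>2)"
    by (simp only: of_real_sum of_real_mult complex_norm_square)
  finally show "0 \<le> Re (quad S (\<lambda>s t. if s = t then of_real (g s) else 0) v)"
    using assms(2) by (simp add: sum_nonneg)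
qed auto

text \<open>Both inputs travel as basis states, and the referee's effect is the truth table of
  \<open>f\<close> on the diagonal.\<close>

lemma smp_protocol_trivial: "smp_protocol n f (2 * n)"
proof -
  let ?X = "{x :: bool list. length x = n}"
  obtain c where c: "bij_betw c ?X {..<2^n :: nat}" using bij_betw_bool_lists by blast
  define dec where "dec = inv_into ?X c"
  have dec: "dec (c x) = x" if "length x = n" for x
    using c that by (simp add: dec_def bij_betw_def)
  have lt: "c x < 2^n" if "length x = n" for x using bij_betwE[OF c] that by auto
  define A :: "bool list \<Rightarrow> cmat" where
    "A x i j = of_bool (i = c x) * cnj (of_bool (j = c x))" for x i j
  define g :: "nat \<Rightarrow> real" where "g i = of_bool (f (dec (i mod 2^n)) (dec (i div 2^n)))" for i
  define E :: cmat where "E i j = (if i = j then of_real (g i) else 0)" for i j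
  have dens: "density_m (2^n) (A x)" if "length x = n" for x
  proof -
    have "(\<Sum>i<2^n. (cmod (of_bool (i = c x)))\<^sup>2) = (\<Sum>i<2^n. if i = c x then 1 else 0)"
      by (intro sum.cong) auto
    also have "\<dots> = 1" using lt[OF that] by simp
    finally show ?thesis unfolding A_def by (rule density_m_pure)
  qed
  have eff: "effect_m (2^(n+n)) E"
  proof -
    have "psd_on {..<2^(n+n)} (\<lambda>i j. if i = j then of_real (g i) else 0)"
      "psd_on {..<2^(n+n)} (\<lambda>i j. if i = j then of_real (1 - g i) else 0)"
      by (rule psd_on_diagonal; simp add: g_def)+
    moreover have "(\<lambda>i j. id_on i j - E i j) = (\<lambda>i j. if i = j then of_real (1 - g i) else 0)"
      by (auto simp: id_on_def E_def fun_eq_iff)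
    ultimately show ?thesis unfolding effect_m_iff effect_on_def by (simp add: E_def[abs_def])
  qed
  have prob: "smp_accept_prob n n E (A x) (A y) = of_bool (f x y)" if "length x = n" "length y = n" for x y
  proof -
    define k where "k = c x + 2^n * c y"
    have k: "k mod 2^n = c x" "k div 2^n = c y" using lt that by (auto simp: k_def)
    have kl: "k < 2^(n+n)"
    proof -
      have "k < 2^n * Suc (c y)" using lt[OF that(1)] by (simp add: k_def)
      also have "\<dots> \<le> 2^n * 2^n" using lt[OF that(2)] by (intro mult_le_mono2) simp
      finally show ?thesis by (simp add: power_add)
    qed
    have "(\<Sum>i<2^(n+n). \<Sum>j<2^(n+n). E i j * kron_m n (A x) (A y) j i)
        = (\<Sum>i<2^(n+n). of_real (g i) * kron_m n (A x) (A y) i i)"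
      by (simp add: E_def if_distrib[of "\<lambda>z. z * _"] cong: if_cong)
    also have "\<dots> = (\<Sum>i<2^(n+n). if i = k then of_real (g k) else 0)"
    proof (rule sum.cong[OF refl])
      fix i
      have "i = k" if "i mod 2^n = c x" "i div 2^n = c y"
        using that k by (metis div_mult_mod_eq)
      then have "i mod 2^n = c x \<and> i div 2^n = c y \<longleftrightarrow> i = k" using k by blast
      then show "of_real (g i) * kron_m n (A x) (A y) i i = (if i = k then complex_of_real (g k) else 0)"
        unfolding kron_m_def A_def by (cases "i = k") auto
    qed
    also have "\<dots> = of_real (of_bool (f x y))"
      using kl by (simp add: g_def k dec that)
    finally show ?thesis unfolding smp_accept_prob_def by simp
  qed
  have "if f x y then smp_accept_prob n n E (A x) (A y) \<ge> 2/3
      else smp_accept_prob n n E (A x) (A y) \<le> 1/3" if "length x = n" "length y = n" for x y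
    by (simp add: prob[OF that])
  moreover have "n + n \<le> 2 * n" by simp
  ultimately show ?thesis unfolding smp_protocol_def using dens eff by blast
qed

section \<open>A public-coin protocol for every function\<close>

definition permutation_m :: "(nat \<Rightarrow> nat) \<Rightarrow> cmat" where
  "permutation_m \<pi> j k = of_bool (j = \<pi> k)"

lemma unitary_permutation_m:
  assumes "bij_betw \<pi> {..<d} {..<d}"
  shows "unitary_m d (permutation_m \<pi>)"
  unfolding unitary_m_def
proof (intro allI impI)
  fix i k assume ik: "i < d" "k < d"
  have "(\<Sum>j<d. cnj (permutation_m \<pi> j i) * permutation_m \<pi> j k) = (\<Sum>j<d. if j = \<pi> i then of_bool (\<pi> i = \<pi> k) else 0)"
    by (intro sum.cong) (auto simp: permutation_m_def)
  also have "\<dots> = of_bool (\<pi> i = \<pi> k)"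
    using bij_betwE[OF assms] ik by simp
  also have "\<dots> = id_m i k"
    using assms ik by (auto simp: id_m_def bij_betw_def inj_on_def)
  finally show "(\<Sum>j<d. cnj (permutation_m \<pi> j i) * permutation_m \<pi> j k) = id_m i k" .
qed

lemma apply_permutation_m:
  assumes "s < d"
  shows "apply_m d (permutation_m \<pi>) (\<lambda>j. of_bool (j = s)) = (\<lambda>j. of_bool (j = \<pi> s))"
proof
  fix j
  have "apply_m d (permutation_m \<pi>) (\<lambda>j. of_bool (j = s)) j = (\<Sum>k<d. if k = s then of_bool (j = \<pi> s) else 0)"
    unfolding apply_m_def by (intro sum.cong) (auto simp: permutation_m_def)
  then show "apply_m d (permutation_m \<pi>) (\<lambda>j. of_bool (j = s)) j = of_bool (j = \<pi> s)"
    using assms by simp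
qed

lemma bij_betw_involution:
  assumes "\<And>j. j \<in> S \<Longrightarrow> \<pi> j \<in> S \<and> \<pi> (\<pi> j) = j"
  shows "bij_betw \<pi> S S"
  by (rule bij_betw_byWitness[where f' = \<pi>]) (use assms in auto)

lemma acts_on_all: "acts_on N {..<N} U"
proof -
  have eq: "j = j'" if "j < 2^N" "j' < 2^N" "\<forall>i\<in>{..<N}. bit j i = bit j' i" for j j' :: nat
  proof -
    have "take_bit N j = take_bit N j'"
      using that(3) by (intro bit_eqI) (auto simp: bit_take_bit_iff)
    then show ?thesis using that(1,2) by (simp add: take_bit_nat_eq_self)
  qed
  show ?thesis
    unfolding acts_on_def
  proof (intro conjI allI impI)
    fix j k j' k' :: nat
    assume "j < 2^N" "k < 2^N" "j' < 2^N" "k' < 2^N" "\<forall>i\<in>{..<N}. bit j i = bit j' i \<and> bit k i = bit k' i"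
    then show "U j k = U j' k'" using eq[of j j'] eq[of k k'] by simp
  qed auto
qed

text \<open>\<open>Q_pub\<close> is a \<open>LEAST\<close>, so it is attained only once some
  protocol is known to exist. Here Alice writes her input and sends every qubit, and Bob flips the
  output qubit if the answer is 1.\<close>

lemma pub_protocol_exists: "\<exists>c P. pub_protocol n f c P"
proof -
  let ?X = "{x :: bool list. length x = n}"
  obtain c where c: "bij_betw c ?X {..<2^n :: nat}" using bij_betw_bool_lists by blast
  define dec where "dec = inv_into ?X c"
  have dec: "dec (c x) = x" if "length x = n" for x
    using c that by (simp add: dec_def bij_betw_def)
  have lt: "c x < 2^n" if "length x = n" for x using bij_betwE[OF c] that by auto
  \<comment> \<open>Only the image of the initial index 0 matters; a transposition extends it to a
    permutation.\<close>
  define \<pi> where "\<pi> x j = (if j = 0 then c x else if j = c x then 0 else j)" for x and j :: nat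
  \<comment> \<open>Adding \<open>2^n\<close> modulo \<open>2^(Suc n)\<close> toggles qubit
    \<open>n\<close> and keeps the low bits that hold Alice's input, so this is an
    involution.\<close>
  define \<tau> where "\<tau> y j = (if f (dec (j mod 2^n)) y then (j + 2^n) mod 2^(Suc n) else j)" for y and j :: nat
  define rs :: "round list" where "rs = [(True, \<lambda>x. permutation_m (\<pi> x), {..<Suc n}), (False, \<lambda>y. permutation_m (\<tau> y), {})]"
  define p :: qprotocol where "p = (Suc n, \<lambda>_. True, rs, n)"
  have \<pi>: "bij_betw (\<pi> x) {..<2^Suc n} {..<2^Suc n}" if "length x = n" for x
    using lt[OF that] by (intro bij_betw_involution) (auto simp: \<pi>_def)
  have \<tau>: "bij_betw (\<tau> y) {..<2^Suc n} {..<2^Suc n}" for y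
  proof (intro bij_betw_involution conjI)
    fix j :: nat assume j: "j \<in> {..<2^Suc n}"
    then show "\<tau> y j \<in> {..<2^Suc n}" by (simp add: \<tau>_def)
    have "(j + 2^n) mod 2^Suc n mod 2^n = j mod 2^n"
      by (simp add: mod_mod_cancel)
    moreover have "((j + 2^n) mod 2^Suc n + 2^n) mod 2^Suc n = j"
    proof -
      have "((j + 2^n) mod 2^Suc n + 2^n) mod 2^Suc n = (j + 2^n + 2^n) mod 2^Suc n"
        by (rule mod_add_left_eq)
      also have "j + 2^n + 2^n = j + 2^Suc n" by simp
      also have "(j + 2^Suc n) mod 2^Suc n = j"
        using j by (simp only: mod_add_self2) simp
      finally show ?thesis .
    qed
    ultimately show "\<tau> y (\<tau> y j) = j" by (simp add: \<tau>_def del: power_Suc)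
  qed
  have "valid_qprotocol n p"
    using \<pi> \<tau> unitary_permutation_m acts_on_all[unfolded lessThan_def]
    by (auto simp: p_def rs_def valid_qprotocol_def simp del: power_Suc)
  moreover have "qprotocol_cost p = Suc n"
    by (simp add: p_def rs_def qprotocol_cost_def)
  moreover have "prob_output_one p x y = of_bool (f x y)" if x: "length x = n" and y: "length y = n" for x y
  proof -
    have i: "init_state = (\<lambda>j. of_bool (j = 0))" by (auto simp: init_state_def)
    have \<pi>0: "\<pi> x 0 = c x" by (simp add: \<pi>_def)
    have cx: "c x < 2^Suc n" using lt[OF x] by simp
    have run: "run_rounds (Suc n) x y rs init_state = (\<lambda>j. of_bool (j = \<tau> y (c x)))"
      using cx by (simp add: rs_def i apply_permutation_m \<pi>0 del: power_Suc)
    have t: "\<tau> y (c x) = c x + (if f x y then 2^n else 0)"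
      using lt[OF x] by (simp add: \<tau>_def dec[OF x])
    have "prob_output_one p x y = (\<Sum>j<2^Suc n. if j = \<tau> y (c x) then of_bool (bit (\<tau> y (c x)) n) else 0)"
      unfolding p_def prob_output_one_def prod.case run by (intro sum.cong) auto
    also have "\<dots> = of_bool (bit (\<tau> y (c x)) n)"
      using bij_betwE[OF \<tau>, of y] cx by simp
    also have "bit (\<tau> y (c x)) n \<longleftrightarrow> f x y"
      using lt[OF x] by (simp add: t bit_iff_odd)
    finally show ?thesis .
  qed
  ultimately have "pub_protocol n f (Suc n) (return_pmf p)"
    by (auto simp: pub_protocol_def)
  then show ?thesis by blast
qed

section \<open>Newman's theorem and fingerprints\<close>

definition success_prob :: "(bool list \<Rightarrow> bool list \<Rightarrow> bool) \<Rightarrow> qprotocol \<Rightarrow> bool list \<Rightarrow> bool list \<Rightarrow> real" where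
  "success_prob f p x y = (if f x y then prob_output_one p x y else 1 - prob_output_one p x y)"

text \<open>A convex function lies below its chord, here on the interval from 0 to 1. The chord is
  affine in \<open>s\<close>, so an average of it depends only on the average success probability; a
  mean of 2/3 gives the factor 1 - 1/3.\<close>

lemma two_powr_minus_le:
  fixes s :: real
  assumes "0 \<le> s" "s \<le> 1"
  shows "2 powr (- s) \<le> 1 - s / 2"
proof -
  have "exp ((1 - s) *\<^sub>R 0 + s *\<^sub>R (- ln 2)) \<le> (1 - s) * exp 0 + s * exp (- ln (2::real))"
    using assms by (intro convex_onD[OF exp_convex]) auto
  then show ?thesis by (simp add: powr_def exp_minus field_simps)
qed

text \<open>Newman's reduction of the public randomness, derandomized: the potential
  \<Sum>(x,y) 2^(-s(x,y)), with s the summed success probability so far, can be decreased by a factor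
  2/3 by an appropriate choice of the next seed.\<close>

lemma public_coin_potential:
  assumes P: "pub_protocol n f c P"
  shows "\<exists>r. (\<forall>i<R. r i \<in> set_pmf P) \<and>
    (\<Sum>(x, y)\<in>{x. length x = n} \<times> {y. length y = n}. 2 powr (- (\<Sum>i<R. success_prob f (r i) x y)))
      \<le> (2/3)^R * 4^n"
proof (induction R)
  case 0
  have "card {x :: bool list. length x = n} = 2^n"
    using card_lists_length_eq[of "UNIV :: bool set" n] by simp
  then have "real (card ({x :: bool list. length x = n} \<times> {y :: bool list. length y = n})) = 4^n"
    by (simp add: card_cartesian_product flip: power_mult_distrib)
  then show ?case by (simp add: case_prod_unfold)
next
  case (Suc R)
  then obtain r where r: "\<forall>i<R. r i \<in> set_pmf P"
    "(\<Sum>(x, y)\<in>{x. length x = n} \<times> {y. length y = n}. 2 powr (- (\<Sum>i<R. success_prob f (r i) x y)))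
      \<le> (2/3)^R * 4^n" by blast
  let ?X = "{x :: bool list. length x = n}"
  let ?XX = "?X \<times> ?X"
  define W where "W z = 2 powr (- (\<Sum>i<R. success_prob f (r i) (fst z) (snd z)))" for z
  have W: "0 \<le> W z" for z by (simp add: W_def)
  have valid: "valid_qprotocol n p" if "p \<in> set_pmf P" for p
    using P that by (simp add: pub_protocol_def)
  have s: "0 \<le> success_prob f p (fst z) (snd z)" "success_prob f p (fst z) (snd z) \<le> 1"
    if "p \<in> set_pmf P" "z \<in> ?XX" for p z
    using prob_output_one_bounds[OF valid[OF that(1)], of "fst z" "snd z"] that(2)
    by (auto simp: success_prob_def)
  have int: "integrable (measure_pmf P) (\<lambda>p. success_prob f p (fst z) (snd z))" if "z \<in> ?XX" for z
    using s that by (intro measure_pmf.integrable_const_bound[where B = 1]) (auto simp: AE_measure_pmf_iff)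
  \<comment> \<open>The chord bound on the potential after adding the seed \<open>p\<close>. Its
    expectation is computed by linearity, and some seed in the support does no worse than
    that.\<close>
  define h where "h p = (\<Sum>z\<in>?XX. W z * (1 - success_prob f p (fst z) (snd z) / 2))" for p
  have inth: "integrable (measure_pmf P) h"
    unfolding h_def by (intro Bochner_Integration.integrable_sum integrable_mult_right Bochner_Integration.integrable_diff
        integrable_divide int) auto
  have "measure_pmf.expectation P h = (\<Sum>z\<in>?XX. W z * (1 - measure_pmf.expectation P (\<lambda>p. success_prob f p (fst z) (snd z)) / 2))"
    unfolding h_def using int by (subst Bochner_Integration.integral_sum) (auto intro!: sum.cong)
  also have "\<dots> \<le> (\<Sum>z\<in>?XX. W z * (2/3))"
  proof (intro sum_mono mult_left_mono W)
    fix z assume "z \<in> ?XX"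
    then have "length (fst z) = n" "length (snd z) = n" by auto
    then have "measure_pmf.expectation P (\<lambda>p. success_prob f p (fst z) (snd z)) \<ge> 2/3"
      using P unfolding pub_protocol_def success_prob_def by blast
    then show "1 - measure_pmf.expectation P (\<lambda>p. success_prob f p (fst z) (snd z)) / 2 \<le> 2/3" by simp
  qed
  finally have "measure_pmf.expectation P h \<le> 2/3 * (\<Sum>z\<in>?XX. W z)"
    by (simp add: sum_distrib_left mult.commute)
  then obtain p where p: "p \<in> set_pmf P" "h p \<le> 2/3 * (\<Sum>z\<in>?XX. W z)"
    using measure_pmf.expectation_greater[OF inth, of "2/3 * (\<Sum>z\<in>?XX. W z)"]
    by (force simp: AE_measure_pmf_iff)
  define r' where "r' = r(R := p)"
  have "(\<Sum>i<Suc R. success_prob f (r' i) x y) = (\<Sum>i<R. success_prob f (r i) x y) + success_prob f p x y" for x y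
    by (simp add: r'_def)
  then have "(\<Sum>(x, y)\<in>?XX. 2 powr (- (\<Sum>i<Suc R. success_prob f (r' i) x y)))
     = (\<Sum>z\<in>?XX. W z * 2 powr (- success_prob f p (fst z) (snd z)))"
    by (simp add: case_prod_unfold W_def powr_diff powr_minus field_simps powr_add)
  also have "\<dots> \<le> h p"
    unfolding h_def using s[OF p(1)] by (intro sum_mono mult_left_mono two_powr_minus_le W)
  also have "\<dots> \<le> 2/3 * (\<Sum>z\<in>?XX. W z)" by (rule p)
  also have "\<dots> \<le> (2/3)^Suc R * 4^n"
    using r(2) by (simp add: W_def case_prod_unfold)
  finally show ?case
    using r(1) p(1) by (intro exI[of _ r']) (auto simp: r'_def less_Suc_eq)
qed

text \<open>Each input pair contributes one term to the potential, so a bound on the sum bounds them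
  all, in place of a union bound over \<open>4^n\<close> pairs. The mean success drops from 2/3 to
  40/72 = 5/9, still a constant above 1/2.\<close>

lemma public_coin_sparsify:
  assumes P: "pub_protocol n f c P"
  shows "\<exists>r. (\<forall>i<72*n. r i \<in> set_pmf P) \<and>
    (\<forall>x y. length x = n \<longrightarrow> length y = n \<longrightarrow> (\<Sum>i<72*n. success_prob f (r i) x y) \<ge> 40 * n)"
proof -
  obtain r where r: "\<forall>i<72*n. r i \<in> set_pmf P" and pot:
    "(\<Sum>(x, y)\<in>{x. length x = n} \<times> {y. length y = n}. 2 powr (- (\<Sum>i<72*n. success_prob f (r i) x y)))
      \<le> (2/3)^(72*n) * 4^n"
    using public_coin_potential[OF P] by blast
  have "(\<Sum>i<72*n. success_prob f (r i) x y) \<ge> 40 * n" if "length x = n" "length y = n" for x y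
  proof -
    have fin: "finite {x :: bool list. length x = n}"
      using finite_lists_length_eq[of "UNIV :: bool set" n] by simp
    have "2 powr (- (\<Sum>i<72*n. success_prob f (r i) x y)) \<le> (2/3)^(72*n) * 4^n"
      using member_le_sum[of "(x, y)" "{x. length x = n} \<times> {y. length y = n}"
          "\<lambda>(x, y). 2 powr (- (\<Sum>i<72*n. success_prob f (r i) x y))"] that fin pot
      by auto
    also have "\<dots> = ((2/3)^72 * 4)^n"
      by (simp add: power_mult power_mult_distrib)
    \<comment> \<open>72 seeds per input bit suffice because 2^114 \<le> 3^72.\<close>
    also have "\<dots> \<le> ((1/2)^40)^n"
      by (intro power_mono) (simp_all add: field_simps)
    also have "\<dots> = 2 powr (- real (40 * n))"
      by (simp only: powr_minus powr_realpow power_mult[symmetric] zero_less_numeral power_one_over inverse_eq_divide)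
    finally show ?thesis by (simp only: powr_le_cancel_iff neg_le_iff_le one_less_numeral_iff semiring_norm)
  qed
  with r show ?thesis by blast
qed

section \<open>Fingerprints and the final protocol\<close>

text \<open>The deficits of the norms go to two separate coordinates, which do not meet in the inner product.\<close>

lemma pad_to_unit_vectors:
  fixes a b :: "bool list \<Rightarrow> nat \<Rightarrow> complex"
  assumes a: "\<And>x. length x = n \<Longrightarrow> (\<Sum>k<m. (cmod (a x k))\<^sup>2) \<le> 1"
    and b: "\<And>y. length y = n \<Longrightarrow> (\<Sum>k<m. (cmod (b y k))\<^sup>2) \<le> 1"
    and D: "m + 2 \<le> D"
  obtains a' b' :: "bool list \<Rightarrow> nat \<Rightarrow> complex"
  where "\<And>x. length x = n \<Longrightarrow> (\<Sum>k<D. (cmod (a' x k))\<^sup>2) = 1"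
    and "\<And>y. length y = n \<Longrightarrow> (\<Sum>k<D. (cmod (b' y k))\<^sup>2) = 1"
    and "\<And>x y. (\<Sum>k<D. cnj (a' x k) * b' y k) = (\<Sum>k<m. cnj (a x k) * b y k)"
proof
  define a' where "a' x k = (if k < m then a x k else if k = m then of_real (sqrt (1 - (\<Sum>k<m. (cmod (a x k))\<^sup>2))) else 0)" for x k
  define b' where "b' y k = (if k < m then b y k else if k = Suc m then of_real (sqrt (1 - (\<Sum>k<m. (cmod (b y k))\<^sup>2))) else 0)" for y k
  have split: "(\<Sum>k<D. g k) = (\<Sum>k<m. g k) + g m + g (Suc m)"
    if "\<And>k. Suc m < k \<Longrightarrow> g k = 0" for g :: "nat \<Rightarrow> 'a :: comm_monoid_add"
  proof -
    have "(\<Sum>k<D. g k) = (\<Sum>k<m + 2. g k)"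
      using D that by (intro sum.mono_neutral_right) auto
    then show ?thesis by (simp add: numeral_2_eq_2)
  qed
  show "(\<Sum>k<D. (cmod (a' x k))\<^sup>2) = 1" if "length x = n" for x
    using a[OF that] by (subst split) (auto simp: a'_def)
  show "(\<Sum>k<D. (cmod (b' y k))\<^sup>2) = 1" if "length y = n" for y
    using b[OF that] by (subst split) (auto simp: b'_def)
  show "(\<Sum>k<D. cnj (a' x k) * b' y k) = (\<Sum>k<m. cnj (a x k) * b y k)" for x y
    by (subst split) (auto simp: a'_def b'_def)
qed

text \<open>\<open>K\<close> is the acceptance probability averaged over the \<open>72 * n\<close>
  seeds. An index has the pair of transcripts as its low part and the seed as its high part; the two
  extra dimensions are for the padding.\<close>

lemma fingerprints_exist:
  assumes P: "pub_protocol n f q P" and n: "0 < n" and D: "4^q * (72 * n) + 2 \<le> D"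
  obtains a b :: "bool list \<Rightarrow> nat \<Rightarrow> complex" and K :: "bool list \<Rightarrow> bool list \<Rightarrow> real"
  where "\<And>x. length x = n \<Longrightarrow> (\<Sum>k<D. (cmod (a x k))\<^sup>2) = 1"
    and "\<And>y. length y = n \<Longrightarrow> (\<Sum>k<D. (cmod (b y k))\<^sup>2) = 1"
    and "\<And>x y. length x = n \<Longrightarrow> length y = n \<Longrightarrow>
      (\<Sum>k<D. cnj (a x k) * b y k) = of_real (K x y / 4^q) \<and>
      0 \<le> K x y \<and> K x y \<le> 1 \<and> (if f x y then 5/9 \<le> K x y else K x y \<le> 4/9)"
proof -
  let ?R = "72 * n"
  obtain r where r: "\<And>i. i < ?R \<Longrightarrow> r i \<in> set_pmf P" and
    succ: "\<And>x y. length x = n \<Longrightarrow> length y = n \<Longrightarrow> (\<Sum>i<?R. success_prob f (r i) x y) \<ge> 40 * n"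
    using public_coin_sparsify[OF P] by blast
  have valid: "valid_qprotocol n (r i)" "qprotocol_cost (r i) \<le> q" if "i < ?R" for i
    using P r[OF that] by (auto simp: pub_protocol_def)
  define good where "good i u v \<longleftrightarrow>
    (\<forall>x. length x = n \<longrightarrow> (\<Sum>l<4^q. (cmod (u x l))\<^sup>2) \<le> 4^q) \<and>
    (\<forall>y. length y = n \<longrightarrow> (\<Sum>l<4^q. (cmod (v y l))\<^sup>2) \<le> 4^q) \<and>
    (\<forall>x y. length x = n \<longrightarrow> length y = n \<longrightarrow>
       of_real (prob_output_one (r i) x y) = (\<Sum>l<4^q. u x l * v y l))" for i and u v :: "bool list \<Rightarrow> nat \<Rightarrow> complex"
  have "\<exists>u v. good i u v" if "i < ?R" for i
    unfolding good_def by (rule prob_output_one_inner_product[OF valid[OF that]])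
  then obtain u v where uv: "\<And>i. i < ?R \<Longrightarrow> good i (u i) (v i)" by metis
  define K where "K x y = (\<Sum>i<?R. prob_output_one (r i) x y) / ?R" for x y
  define c where "c = sqrt (?R * 4^q)"
  have c: "c\<^sup>2 = ?R * 4^q" "0 < c" using n by (auto simp: c_def)
  \<comment> \<open>Conjugated, because the inner product conjugates its first argument and the
    decomposition of the probability does not.\<close>
  define a where "a x k = cnj (u (k div 4^q) x (k mod 4^q)) / c" for x k
  define b where "b y k = v (k div 4^q) y (k mod 4^q) / c" for y k
  have norm: "(\<Sum>k<4^q * ?R. (cmod (w (k div 4^q) (k mod 4^q) / of_real c))\<^sup>2) \<le> 1"
    if "\<And>i. i < ?R \<Longrightarrow> (\<Sum>l<4^q. (cmod (w i l))\<^sup>2) \<le> 4^q" for w :: "nat \<Rightarrow> nat \<Rightarrow> complex"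
  proof -
    have "(\<Sum>k<4^q * ?R. (cmod (w (k div 4^q) (k mod 4^q) / of_real c))\<^sup>2)
      = (\<Sum>l<4^q. \<Sum>i<?R. (cmod (w i l / of_real c))\<^sup>2)"
      by (rule sum_mod_div[of "4^q" "\<lambda>l i. (cmod (w i l / of_real c))\<^sup>2"]) simp
    also have "\<dots> = (\<Sum>i<?R. \<Sum>l<4^q. (cmod (w i l / of_real c))\<^sup>2)"
      by (rule sum.swap)
    also have "\<dots> = (\<Sum>i<?R. (\<Sum>l<4^q. (cmod (w i l))\<^sup>2)) / c\<^sup>2"
      by (simp add: norm_divide power_divide sum_divide_distrib)
    also have "\<dots> \<le> (\<Sum>i<?R. 4^q) / c\<^sup>2"
      using that c by (intro divide_right_mono sum_mono) auto
    also have "\<dots> = 1" using n by (simp add: c)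
    finally show ?thesis .
  qed
  have na: "(\<Sum>k<4^q * ?R. (cmod (a x k))\<^sup>2) \<le> 1" if "length x = n" for x
    unfolding a_def using uv that by (intro norm[of "\<lambda>i l. cnj (u i x l)"]) (simp add: good_def)
  have nb: "(\<Sum>k<4^q * ?R. (cmod (b y k))\<^sup>2) \<le> 1" if "length y = n" for y
    unfolding b_def using uv that by (intro norm[of "\<lambda>i l. v i y l"]) (simp add: good_def)
  have inner: "(\<Sum>k<4^q * ?R. cnj (a x k) * b y k) = of_real (K x y / 4^q)"
    if "length x = n" "length y = n" for x y
  proof -
    have "(\<Sum>k<4^q * ?R. cnj (a x k) * b y k) = (\<Sum>l<4^q. \<Sum>i<?R. u i x l * v i y l / of_real (c\<^sup>2))"
      unfolding a_def b_def
      using sum_mod_div[of "4^q" "\<lambda>l i. u i x l * v i y l / complex_of_real (c\<^sup>2)" ?R]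
      by (simp add: power2_eq_square)
    also have "\<dots> = (\<Sum>i<?R. \<Sum>l<4^q. u i x l * v i y l / of_real (c\<^sup>2))"
      by (rule sum.swap)
    also have "\<dots> = (\<Sum>i<?R. of_real (prob_output_one (r i) x y)) / of_real (c\<^sup>2)"
      using uv that by (simp add: good_def sum_divide_distrib)
    also have "\<dots> = of_real (K x y / 4^q)"
      unfolding c(1) K_def by simp
    finally show ?thesis .
  qed
  have K: "0 \<le> K x y \<and> K x y \<le> 1 \<and> (if f x y then 5/9 \<le> K x y else K x y \<le> 4/9)"
    if xy: "length x = n" "length y = n" for x y
  proof -
    have "0 \<le> (\<Sum>i<?R. prob_output_one (r i) x y)"
      using prob_output_one_bounds[OF valid(1) xy] by (intro sum_nonneg) simp
    moreover have "(\<Sum>i<?R. prob_output_one (r i) x y) \<le> (\<Sum>i<?R. 1)"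
      using prob_output_one_bounds[OF valid(1) xy] by (intro sum_mono) simp
    \<comment> \<open>When \<open>f x y\<close> is false, \<open>40 * n\<close> successes leave at
      most \<open>32 * n\<close> for output one, hence 32/72 = 4/9.\<close>
    moreover have "(\<Sum>i<?R. success_prob f (r i) x y) =
        (if f x y then \<Sum>i<?R. prob_output_one (r i) x y else ?R - (\<Sum>i<?R. prob_output_one (r i) x y))"
      by (simp add: success_prob_def sum_subtractf)
    ultimately show ?thesis
      using succ[OF xy] n by (auto simp: K_def field_simps split: if_splits)
  qed
  obtain a' b' :: "bool list \<Rightarrow> nat \<Rightarrow> complex"
    where a': "\<And>x. length x = n \<Longrightarrow> (\<Sum>k<D. (cmod (a' x k))\<^sup>2) = 1"
    and b': "\<And>y. length y = n \<Longrightarrow> (\<Sum>k<D. (cmod (b' y k))\<^sup>2) = 1"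
    and ab': "\<And>x y. (\<Sum>k<D. cnj (a' x k) * b' y k) = (\<Sum>k<4^q * ?R. cnj (a x k) * b y k)"
    using pad_to_unit_vectors[where a = a and b = b, OF na nb D] by blast
  show thesis
  proof (rule that[of a' b' K, OF a' b'])
    fix x y :: "bool list" assume xy: "length x = n" "length y = n"
    show "(\<Sum>k<D. cnj (a' x k) * b' y k) = of_real (K x y / 4^q) \<and>
      0 \<le> K x y \<and> K x y \<le> 1 \<and> (if f x y then 5/9 \<le> K x y else K x y \<le> 4/9)"
      unfolding ab' inner[OF xy] using K[OF xy] by (rule conjI[OF refl])
  qed
qed

text \<open>With \<open>L = 16^q\<close> a swap test passes with probability
  \<open>(1 + K^2/L)/2\<close>. The values 5/9 and 4/9 of \<open>K\<close> put the mean number of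
  passes \<open>T/(36*L)\<close> above or below the midpoint, while the variance is at most
  \<open>T/4\<close>. Chebyshev's bound \<open>324 * L^2 / T\<close> is 1/4 at
  \<open>T = 1296 * L^2\<close>.\<close>

lemma smp_protocol_of_pub_protocol:
  assumes P: "pub_protocol n f q P" and n: "0 < n" and d: "4^q * (72 * n) + 2 \<le> 2^d"
  shows "smp_protocol n f (2 * d * (1296 * 2^(8*q)))"
proof -
  obtain a b :: "bool list \<Rightarrow> nat \<Rightarrow> complex" and K :: "bool list \<Rightarrow> bool list \<Rightarrow> real"
    where a: "\<And>x. length x = n \<Longrightarrow> (\<Sum>k<2^d. (cmod (a x k))\<^sup>2) = 1"
    and b: "\<And>y. length y = n \<Longrightarrow> (\<Sum>k<2^d. (cmod (b y k))\<^sup>2) = 1"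
    and K: "\<And>x y. length x = n \<Longrightarrow> length y = n \<Longrightarrow>
      (\<Sum>k<2^d. cnj (a x k) * b y k) = of_real (K x y / 4^q) \<and>
      0 \<le> K x y \<and> K x y \<le> 1 \<and> (if f x y then 5/9 \<le> K x y else K x y \<le> 4/9)"
    using fingerprints_exist[OF P n d] by blast
  define L :: real where "L = (4^q)\<^sup>2"
  \<comment> \<open>T p is at least 648 L^2 + 200 L or at most 648 L^2 + 128 L; h is the midpoint.\<close>
  define T :: nat where "T = 1296 * 2^(8*q)"
  define h :: nat where "h = 648 * 2^(8*q) + 164 * 2^(4*q)"
  have L: "0 < L" by (simp add: L_def)
  have "(4::real)^q = 2^(2*q)" by (simp add: power_mult)
  then have L4: "L = 2^(4*q)" unfolding L_def by (simp flip: power_mult)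
  have L8: "L\<^sup>2 = 2^(8*q)" unfolding L4 power_mult[symmetric] by simp
  have T: "real T = 1296 * L\<^sup>2" and h: "real h = 648 * L\<^sup>2 + 164 * L"
    by (simp_all add: T_def h_def L8 flip: L4)
  show ?thesis
    unfolding T_def[symmetric]
  proof (rule smp_protocol_of_fingerprints[where h = h, OF a b])
    fix x y :: "bool list" assume xy: "length x = n" "length y = n"
    let ?K = "K x y"
    define p where "p = (1 + (cmod (\<Sum>k<2^d. cnj (a x k) * b y k))\<^sup>2) / 2"
    have K01: "0 \<le> ?K" "?K \<le> 1" and Kf: "if f x y then 5/9 \<le> ?K else ?K \<le> 4/9" using K[OF xy] by auto
    have "cmod (\<Sum>k<2^d. cnj (a x k) * b y k) = ?K / 4^q"
      using K[OF xy] K01 by (simp only: norm_of_real) simp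
    then have p: "p = (1 + ?K\<^sup>2 / L) / 2"
      by (simp add: p_def L_def power_divide)
    have "1 \<le> L" by (simp add: L4)
    then have "?K\<^sup>2 / L \<le> 1"
      using K01 by (simp add: power_le_one order_trans[of _ 1])
    then have p01: "0 \<le> p" "p \<le> 1" using L by (auto simp: p)
    have Tp: "T * p = 648 * L\<^sup>2 + 648 * L * ?K\<^sup>2"
      using L by (simp add: T p field_simps power2_eq_square)
    have "p * (1 - p) \<le> 1/4"
      using zero_le_power2[of "p - 1/2"] by (simp add: power2_eq_square algebra_simps)
    then have "1296 * L\<^sup>2 * (p * (1 - p)) \<le> 1296 * L\<^sup>2 * (1/4)"
      by (intro mult_left_mono) auto
    then have var: "T * p * (1 - p) + (T * p - T * p)\<^sup>2 \<le> 324 * L\<^sup>2"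
      by (simp add: T mult.assoc)
    have dev: "(36 * L)\<^sup>2 = 1296 * L\<^sup>2" by (simp add: power_mult_distrib)
    \<comment> \<open>Shared by both error directions: 324/36^2 = 1/4, within the allowed
      1/3.\<close>
    have quarter: "t \<le> 1/4" if "t * e\<^sup>2 \<le> 324 * L\<^sup>2" "36 * L \<le> e" "0 \<le> t" for t e
    proof -
      have "t * (36 * L)\<^sup>2 \<le> t * e\<^sup>2"
        using that L by (intro mult_left_mono power_mono) auto
      then have "t * (1296 * L\<^sup>2) \<le> 324 * L\<^sup>2" using that(1) unfolding dev by linarith
      then show ?thesis using L by (simp add: field_simps)
    qed
    have tail01: "0 \<le> binomial_tail T h p \<and> binomial_tail T h p \<le> 1" by (rule binomial_tail_bounds[OF p01])
    have "if f x y then binomial_tail T h p \<ge> 2/3 else binomial_tail T h p \<le> 1/3"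
    proof (cases "f x y")
      case True
      have "(5/9)\<^sup>2 \<le> ?K\<^sup>2" using Kf True by (intro power_mono) auto
      then have "648 * L * (5/9)\<^sup>2 \<le> 648 * L * ?K\<^sup>2" using L by (intro mult_left_mono) auto
      then have e: "36 * L \<le> T * p - h" unfolding Tp h by (simp add: power2_eq_square)
      have "(1 - binomial_tail T h p) * (T * p - h)\<^sup>2 \<le> 324 * L\<^sup>2"
        using binomial_tail_lower[OF p01, of h "T * p" T] e L var by linarith
      from quarter[OF this e] tail01 True show ?thesis by auto
    next
      case False
      have "?K\<^sup>2 \<le> (4/9)\<^sup>2" using Kf False K01 by (intro power_mono) auto
      then have "648 * L * ?K\<^sup>2 \<le> 648 * L * (4/9)\<^sup>2" using L by (intro mult_left_mono) auto
      then have e: "36 * L \<le> h - T * p" unfolding Tp h by (simp add: power2_eq_square)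
      have "binomial_tail T h p * (h - T * p)\<^sup>2 \<le> 324 * L\<^sup>2"
        using binomial_tail_upper[OF p01, of "T * p" h T] e L var by linarith
      from quarter[OF this e] tail01 False show ?thesis by auto
    qed
    then show "let t = binomial_tail T h ((1 + (cmod (\<Sum>k<2^d. cnj (a x k) * b y k))\<^sup>2) / 2)
       in if f x y then t \<ge> 2/3 else t \<le> 1/3"
      unfolding Let_def p_def .
  qed
qed

theorem mainTheorem1:
  shows "\<exists>C::real. C > 0 \<and>
    (\<forall>n::nat. n \<ge> 2 \<longrightarrow> (\<forall>f :: bool list \<Rightarrow> bool list \<Rightarrow> bool.
       real (Q_smp n f) \<le> C * 2 ^ (8 * Q_pub n f) * log 2 (real n)))"
proof (intro exI[of _ 31104] conjI allI impI)
  \<comment> \<open>31104 = 2592 * 12: the protocol costs \<open>2592 * 2^(8*q) * d\<close>, and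
    \<open>d\<close> is at most 12 times the logarithm of \<open>n\<close>.\<close>
  show "(0::real) < 31104" by simp
  fix n :: nat and f :: "bool list \<Rightarrow> bool list \<Rightarrow> bool"
  assume n: "2 \<le> n"
  define q where "q = Q_pub n f"
  have "\<exists>P. pub_protocol n f q P"
    unfolding q_def Q_pub_def by (rule LeastI_ex) (rule pub_protocol_exists)
  then obtain P where P: "pub_protocol n f q P" by blast
  have log1: "1 \<le> log 2 (real n)" using n by simp
  have bound: "real (Q_smp n f) \<le> c" if "smp_protocol n f m" "real m \<le> c" for m c
    using Least_le[of "smp_protocol n f" m, OF that(1)] that(2) by (simp add: Q_smp_def)
  show "real (Q_smp n f) \<le> 31104 * 2 ^ (8 * Q_pub n f) * log 2 (real n)"
    unfolding q_def[symmetric]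
  proof (cases "2 * n \<le> 2^(8*q)")
    case True
    have "real (2 * n) \<le> 2^(8*q)" using True by (metis of_nat_le_iff of_nat_numeral of_nat_power)
    also have "\<dots> \<le> (31104 * 2^(8*q)) * log 2 (real n)"
      using mult_mono[of "2^(8*q)" "31104 * 2^(8*q)" 1 "log 2 (real n)"] log1 by simp
    finally show "real (Q_smp n f) \<le> 31104 * 2^(8*q) * log 2 (real n)"
      by (rule bound[OF smp_protocol_trivial])
  next
    case False
    define k where "k = nat \<lceil>log 2 (real n)\<rceil>"
    \<comment> \<open>Then \<open>2^d\<close> is at least \<open>256 * n^2\<close>. In this case
      \<open>4^q \<le> 2 * n\<close>, so the fingerprints need dimension at most
      \<open>144 * n^2 + 2\<close>, which is at most \<open>145 * n^2\<close>.\<close>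
    define d where "d = 8 + 2 * k"
    have k: "real k \<le> log 2 (real n) + 1" using log1 unfolding k_def by linarith
    have "log 2 (real n) \<le> real k" unfolding k_def by linarith
    then have "real n \<le> 2^k" using n by (simp add: log_le_iff powr_realpow)
    then have nk: "n \<le> 2^k" by (metis of_nat_le_iff of_nat_numeral of_nat_power)
    have "(4::nat)^q = 2^(2*q)" by (simp add: power_mult)
    also have "\<dots> \<le> 2^(8*q)" by (intro power_increasing) auto
    also have "\<dots> \<le> 2 * n" using False by simp
    finally have "4^q * (72 * n) + 2 \<le> (2 * n) * (72 * n) + n * n"
      using n by (intro add_mono mult_le_mono) (auto intro: order_trans[of _ "n * 1"] simp del: mult_1_right)
    also have "\<dots> \<le> 2^8 * n\<^sup>2" by (simp add: power2_eq_square)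
    also have "\<dots> \<le> 2^8 * (2^k)\<^sup>2" using nk by (intro mult_le_mono2 power_mono) auto
    also have "\<dots> = 2^d" by (simp add: d_def power_add power_mult flip: power_even_eq)
    finally have "smp_protocol n f (2 * d * (1296 * 2^(8*q)))"
      using n by (intro smp_protocol_of_pub_protocol[OF P]) auto
    moreover have "real (2 * d * (1296 * 2^(8*q))) \<le> 31104 * 2^(8*q) * log 2 (real n)"
    proof -
      have "real d \<le> 12 * log 2 (real n)" using k log1 by (simp add: d_def)
      then have "(2592 * 2^(8*q)) * real d \<le> (2592 * 2^(8*q)) * (12 * log 2 (real n))"
        by (intro mult_left_mono) auto
      then show ?thesis by (simp add: mult_ac)
    qed
    ultimately show "real (Q_smp n f) \<le> 31104 * 2^(8*q) * log 2 (real n)"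
      by (rule bound)
  qed
qed

end
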